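(* Let $(A,[~,\dots,~],a)$ be a Filippov algebroid. There is a bijective correspondence between the second cohomology space $H^2_F(A)$ and the equivalence classes of infinitesimal deformations of $(A,[~,\dots,~],a)$.
   Context: Let $n\ge2$ be fixed, $M$ a smooth manifold, $\chi(M)$ the space of vector fields, $A\to M$ a smooth real vector bundle, $\Gamma A$ its space of smooth sections. A Filippov algebra of order $n$ is a real vector space $L$ with an $\mathbb R$-multilinear skew-symmetric bracket $[~,\dots,~]:L^{n}\to L$ satisfying $[a_1,\dots,a_{n-1},[b_1,\dots,b_n]]=\sum_{i=1}^n[b_1,\dots,b_{i-1},[a_1,\dots,a_{n-1},b_i],b_{i+1},\dots,b_n]$. A Filippov algebroid $(A,[~,\dots,~],a)$ of order $n$ over $M$ is a vector bundle $A$ with a Filippov algebra structure of order $n$ on $\Gamma A$ and a bundle map $a:\wedge^{n-1}A\to TM$ (the anchor) such that (a) $[a(x_1\wedge\cdots\wedge x_{n-1}),a(y_1\wedge\cdots\wedge y_{n-1})]=\sum_{i=1}^{n-1}a(y_1\wedge\cdots\wedge[x_1,\dots,x_{n-1},y_i]\wedge y_{i+1}\wedge\cdots\wedge y_{n-1})$ (Lie bracket of vector fields on the left), and (b) $[x_1,\dots,x_{n-1},fy]=f[x_1,\dots,x_{n-1},y]+a(x_1\wedge\cdots\wedge x_{n-1})(f)y$, for all $x_i,y_i,y\in\Gamma A$, $f\in C^\infty(M)$. Put $\mathcal L(A):=\Gamma A\wedge\cdots\wedge\Gamma A$ ($n-1$ copies); elements are written $X=X^1\wedge\cdots\wedge X^{n-1}$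 (formulas extended linearly). $\mathrm{Der}^0(A)=\mathrm{Der}(A)$ is the set of linear maps $D:\Gamma A\to\Gamma A$ for which there is $\sigma_D\in\chi(M)$ with $D(fz)=fD(z)+\sigma_D(f)z$. $\mathrm{Der}^1(A)$ is the set of $\mathbb R$-linear maps $D:\mathcal L(A)\wedge\Gamma A\to\Gamma A$, written $D(X,z)$ or $D(x_1,\dots,x_n)$ (alternating in all $n$ sections), for which there is a $C^\infty(M)$-multilinear map $\sigma_D:\mathcal L(A)\to\chi(M)$ (the symbol) with $D(X,fz)=fD(X,z)+\sigma_D(X)(f)z$. For $D_1,D_2\in\mathrm{Der}^1(A)$ define $$(D_1\circ D_2)(X_1,X_2,z)=\sum_{s=1}^{n-1}D_1\big(X_2^1\wedge\cdots\wedge X_2^{s-1}\wedge D_2(X_1,X_2^s)\wedge X_2^{s+1}\wedge\cdots\wedge X_2^{n-1},z\big)-D_1(X_1,D_2(X_2,z))+D_1(X_2,D_2(X_1,z))$$ and $[D_1,D_2]:=-D_1\circ D_2-D_2\circ D_1$; for $D_1\in\mathrm{Der}^1(A)$ and $N\in\mathrm{Der}^0(A)$, $[D_1,N](x_1,\dots,x_n)=\sum_{i=1}^nD_1(x_1,\dots,N(x_i),\dots,x_n)-N(D_1(x_1,\dots,x_n))$. The Filippov algebroid structure on $A$ corresponds to $\varphi\in\mathrm{Der}^1(A)$, $\varphi(x_1\wedge\cdots\wedge x_{n-1},y)=[x_1,\dots,x_{n-1},y]$, $\sigma_\varphi=a$, with $[\varphi,\varphi]=0$. Put $C^1_F(A)=\mathrm{Der}^0(A)$,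 $C^2_F(A)=\mathrm{Der}^1(A)$, $\delta_F(\psi)=[\varphi,\psi]$; $H^2_F(A)$ is $\{\psi\in C^2_F(A):\delta_F\psi=0\}$ modulo $\delta_F(C^1_F(A))$. A deformation of order $k$ of the Filippov algebroid is a $t$-parametrized family $\varphi_t=\varphi_0+\sum_{i=1}^kt^i\varphi_i$ with $\varphi_0=\varphi$, $\varphi_i\in\mathrm{Der}^1(A)$, $t\in\mathbb R$, such that $[\varphi_t,\varphi_t]=0$ modulo $t^{k+1}$. An infinitesimal deformation is a deformation of order $1$. Two deformations $\varphi_t$ and $\tilde\varphi_t$ of order $k$ are equivalent if there is an automorphism $\Phi_t:A\to A$ defined as $\Phi_t=\mathrm{Id}+\sum_{i=1}^kt^i\phi_i$, where $\phi_i:A\to A$ is a linear map for $1\le i\le k$, such that $\tilde\varphi_t(x_1,\dots,x_n)=\Phi_t^{-1}\varphi_t(\Phi_tx_1,\dots,\Phi_tx_n)$ modulo $t^{k+1}$; here $\Phi_t$ is invertible modulo $t^{k+1}$ and $\Phi_t^{-1}$ denotes this inverse. For infinitesimal deformations this is applied with $k=1$. *)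

theory Defs
  imports "HOL-Analysis.Analysis" "HOL-Library.Function_Algebras"
begin

text \<open>
  Conventions. Maps are total functions in HOL, so a map on a set is represented by the
  function that is 0 outside that set: functions and sections vanish outside the manifold,
  operators on sections vanish outside the sections. In this way all spaces of
  functions, sections, vector fields and operators are subsets of function types with values in a
  real vector space, with pointwise operations, and equality of maps is equality in HOL.
  A map of \<^term>\<open>k\<close> arguments is a map on lists of length \<^term>\<open>k\<close>; a decomposable
  element of an exterior power is given by the list of its factors.
\<close>

instantiation "fun" :: (type, real_vector) real_vector
begin

definition scaleR_fun :: "real \<Rightarrow> ('a \<Rightarrow> 'b) \<Rightarrow> 'a \<Rightarrow> 'b"
  where "scaleR_fun c f = (\<lambda>x. c *\<^sub>R f x)"

instance
  by standard (simp_all add: scaleR_fun_def fun_eq_iff scaleR_add_right scaleR_add_left)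

end

lemma scaleR_fun_apply [simp]: "(c *\<^sub>R f) x = c *\<^sub>R f x"
  by (simp add: scaleR_fun_def)

section \<open>Multilinear maps\<close>

definition tuples :: "nat \<Rightarrow> 'a set \<Rightarrow> 'a list set" where
  "tuples k S = {xs. length xs = k \<and> set xs \<subseteq> S}"

definition linear_map_on :: "'a::real_vector set \<Rightarrow> ('a \<Rightarrow> 'b::real_vector) \<Rightarrow> bool" where
  "linear_map_on S F \<longleftrightarrow>
     (\<forall>x\<in>S. \<forall>y\<in>S. F (x + y) = F x + F y) \<and> (\<forall>c. \<forall>x\<in>S. F (c *\<^sub>R x) = c *\<^sub>R F x)"

definition multilinear_map_on ::
    "nat \<Rightarrow> 'a::real_vector set \<Rightarrow> ('a list \<Rightarrow> 'b::real_vector) \<Rightarrow> bool" where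
  "multilinear_map_on k S F \<longleftrightarrow>
     (\<forall>xs\<in>tuples k S. \<forall>i<k. linear_map_on S (\<lambda>x. F (xs[i := x])))"

definition skew_on :: "nat \<Rightarrow> 'a set \<Rightarrow> ('a list \<Rightarrow> 'b::real_vector) \<Rightarrow> bool" where
  "skew_on k S F \<longleftrightarrow>
     (\<forall>xs\<in>tuples k S. \<forall>i<k. \<forall>j<k. i \<noteq> j \<longrightarrow> F (xs[i := xs ! j, j := xs ! i]) = - F xs)"

definition linear_endos :: "'a::real_vector set \<Rightarrow> ('a \<Rightarrow> 'a) set" where
  "linear_endos S = {F. linear_map_on S F \<and> (\<forall>x\<in>S. F x \<in> S) \<and> (\<forall>x. x \<notin> S \<longrightarrow> F x = 0)}"

section \<open>Smooth manifolds\<close>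

text \<open>
  Points of $\mathbb R^m$ are sequences \<^typ>\<open>nat \<Rightarrow> real\<close> vanishing from index \<^term>\<open>m\<close> on,
  as in \<^const>\<open>Euclidean_space\<close>; this includes dimension 0.
\<close>

definition partial_deriv :: "nat \<Rightarrow> ((nat \<Rightarrow> real) \<Rightarrow> real) \<Rightarrow> (nat \<Rightarrow> real) \<Rightarrow> real" where
  "partial_deriv i f x = deriv (\<lambda>s. f (x(i := s))) (x i)"

text \<open>Continuous differentiability of order \<^term>\<open>k\<close> on an open subset \<^term>\<open>W\<close> of $\mathbb R^m$.\<close>

primrec C_k_on :: "nat \<Rightarrow> (nat \<Rightarrow> real) set \<Rightarrow> nat \<Rightarrow> ((nat \<Rightarrow> real) \<Rightarrow> real) \<Rightarrow> bool" where
  "C_k_on m W 0 f \<longleftrightarrow>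
     continuous_map (subtopology (Euclidean_space m) W) euclideanreal f"
| "C_k_on m W (Suc k) f \<longleftrightarrow>
     continuous_map (subtopology (Euclidean_space m) W) euclideanreal f \<and>
     (\<forall>i<m. (\<forall>x\<in>W. (\<lambda>s. f (x(i := s))) differentiable (at (x i))) \<and>
        C_k_on m W k (partial_deriv i f))"

definition C_inf_on :: "nat \<Rightarrow> (nat \<Rightarrow> real) set \<Rightarrow> ((nat \<Rightarrow> real) \<Rightarrow> real) \<Rightarrow> bool" where
  "C_inf_on m W f \<longleftrightarrow> (\<forall>k. C_k_on m W k f)"

record 'm manifold =
  mtop :: "'m topology"
  mdim :: nat
  atlas :: "('m set \<times> ('m \<Rightarrow> nat \<Rightarrow> real)) set"

abbreviation points :: "('m, 'z) manifold_scheme \<Rightarrow> 'm set" where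
  "points M \<equiv> topspace (mtop M)"

definition smooth_manifold :: "('m, 'z) manifold_scheme \<Rightarrow> bool" where
  "smooth_manifold M \<longleftrightarrow>
     Hausdorff_space (mtop M) \<and> second_countable (mtop M) \<and>
     (\<forall>(U, c)\<in>atlas M.
        openin (mtop M) U \<and> openin (Euclidean_space (mdim M)) (c ` U) \<and>
        homeomorphic_map (subtopology (mtop M) U)
          (subtopology (Euclidean_space (mdim M)) (c ` U)) c) \<and>
     (\<Union>(U, c)\<in>atlas M. U) = points M \<and>
     (\<forall>(U, c)\<in>atlas M. \<forall>(V, d)\<in>atlas M. \<forall>i<mdim M.
        C_inf_on (mdim M) (c ` (U \<inter> V)) (\<lambda>x. d (inv_into U c x) i))"

definition smooth_on :: "('m, 'z) manifold_scheme \<Rightarrow> 'm set \<Rightarrow> ('m \<Rightarrow> real) \<Rightarrow> bool" where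
  "smooth_on M U f \<longleftrightarrow>
     (\<forall>(V, c)\<in>atlas M. C_inf_on (mdim M) (c ` (U \<inter> V)) (\<lambda>x. f (inv_into V c x)))"

definition smooth_functions :: "('m, 'z) manifold_scheme \<Rightarrow> ('m \<Rightarrow> real) set" where
  "smooth_functions M = {f. smooth_on M (points M) f \<and> (\<forall>p. p \<notin> points M \<longrightarrow> f p = 0)}"

definition tangent_space ::
    "('m, 'z) manifold_scheme \<Rightarrow> 'm \<Rightarrow> (('m \<Rightarrow> real) \<Rightarrow> real) set" where
  "tangent_space M p =
     {v. linear_map_on (smooth_functions M) v \<and>
         (\<forall>f\<in>smooth_functions M. \<forall>g\<in>smooth_functions M. v (f * g) = f p * v g + g p * v f) \<and>
         (\<forall>f. f \<notin> smooth_functions M \<longrightarrow> v f = 0)}"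

text \<open>The function $X(f)$.\<close>

definition vf_apply :: "('m \<Rightarrow> ('m \<Rightarrow> real) \<Rightarrow> real) \<Rightarrow> ('m \<Rightarrow> real) \<Rightarrow> 'm \<Rightarrow> real" where
  "vf_apply X f = (\<lambda>p. X p f)"

definition vector_fields ::
    "('m, 'z) manifold_scheme \<Rightarrow> ('m \<Rightarrow> ('m \<Rightarrow> real) \<Rightarrow> real) set" where
  "vector_fields M =
     {X. (\<forall>p\<in>points M. X p \<in> tangent_space M p) \<and>
         (\<forall>f\<in>smooth_functions M. vf_apply X f \<in> smooth_functions M) \<and>
         (\<forall>p. p \<notin> points M \<longrightarrow> X p = 0)}"

definition vf_bracket ::
    "('m \<Rightarrow> ('m \<Rightarrow> real) \<Rightarrow> real) \<Rightarrow> ('m \<Rightarrow> ('m \<Rightarrow> real) \<Rightarrow> real) \<Rightarrow> 'm \<Rightarrow> ('m \<Rightarrow> real) \<Rightarrow> real"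
  where "vf_bracket X Y = (\<lambda>p f. X p (vf_apply Y f) - Y p (vf_apply X f))"

section \<open>Smooth vector bundles\<close>

text \<open>
  The fibres are linear subspaces of one real vector space \<^typ>\<open>'e\<close>; any family of
  vector spaces is of this form up to isomorphism (embed it into its direct sum). The
  smooth structure is given by local trivialisations with smooth transition functions.
\<close>

record ('m, 'e) vbundle = "'m manifold" +
  fibre :: "'m \<Rightarrow> 'e set"
  rank :: nat
  trivs :: "('m set \<times> ('m \<Rightarrow> 'e \<Rightarrow> nat \<Rightarrow> real)) set"

definition vector_bundle :: "('m, 'e::real_vector) vbundle \<Rightarrow> bool" where
  "vector_bundle A \<longleftrightarrow>
     smooth_manifold A \<and>
     (\<forall>p\<in>points A. subspace (fibre A p)) \<and>
     (\<forall>(U, \<tau>)\<in>trivs A. openin (mtop A) U \<and>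
        (\<forall>p\<in>U. linear_map_on (fibre A p) (\<tau> p) \<and>
           bij_betw (\<tau> p) (fibre A p) (topspace (Euclidean_space (rank A))))) \<and>
     (\<Union>(U, \<tau>)\<in>trivs A. U) = points A \<and>
     (\<forall>(U, \<tau>)\<in>trivs A. \<forall>(V, \<theta>)\<in>trivs A.
        \<forall>w\<in>topspace (Euclidean_space (rank A)). \<forall>i<rank A.
          smooth_on A (U \<inter> V) (\<lambda>p. \<theta> p (inv_into (fibre A p) (\<tau> p) w) i))"

definition sections :: "('m, 'e::real_vector) vbundle \<Rightarrow> ('m \<Rightarrow> 'e) set" where
  "sections A =
     {x. (\<forall>p\<in>points A. x p \<in> fibre A p) \<and>
         (\<forall>(U, \<tau>)\<in>trivs A. \<forall>i<rank A. smooth_on A U (\<lambda>p. \<tau> p (x p) i)) \<and>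
         (\<forall>p. p \<notin> points A \<longrightarrow> x p = 0)}"

text \<open>The module structure over smooth functions, for sections and for vector fields.\<close>

definition fmult :: "('m \<Rightarrow> real) \<Rightarrow> ('m \<Rightarrow> 'v::real_vector) \<Rightarrow> 'm \<Rightarrow> 'v" (infixr "\<odot>" 75) where
  "f \<odot> x = (\<lambda>p. f p *\<^sub>R x p)"

section \<open>Filippov algebroids\<close>

text \<open>
  The anchor is a family of skew multilinear maps
  $a_p : A_p \times \dots \times A_p \to T_pM$. The induced map on sections:
\<close>

definition anchor_map ::
    "('m, 'z) manifold_scheme \<Rightarrow> ('m \<Rightarrow> 'e list \<Rightarrow> ('m \<Rightarrow> real) \<Rightarrow> real)
      \<Rightarrow> ('m \<Rightarrow> 'e) list \<Rightarrow> 'm \<Rightarrow> ('m \<Rightarrow> real) \<Rightarrow> real" where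
  "anchor_map M a xs = (\<lambda>p. if p \<in> points M then a p (map (\<lambda>x. x p) xs) else 0)"

definition bundle_anchor ::
    "nat \<Rightarrow> ('m, 'e::real_vector) vbundle
      \<Rightarrow> ('m \<Rightarrow> 'e list \<Rightarrow> ('m \<Rightarrow> real) \<Rightarrow> real) \<Rightarrow> bool" where
  "bundle_anchor n A a \<longleftrightarrow>
     (\<forall>p\<in>points A.
        multilinear_map_on (n - 1) (fibre A p) (a p) \<and> skew_on (n - 1) (fibre A p) (a p) \<and>
        (\<forall>us\<in>tuples (n - 1) (fibre A p). a p us \<in> tangent_space A p)) \<and>
     (\<forall>xs\<in>tuples (n - 1) (sections A). anchor_map A a xs \<in> vector_fields A)"

definition filippov_algebra ::
    "nat \<Rightarrow> 'a::real_vector set \<Rightarrow> ('a list \<Rightarrow> 'a) \<Rightarrow> bool" where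
  "filippov_algebra n L br \<longleftrightarrow>
     subspace L \<and>
     (\<forall>xs\<in>tuples n L. br xs \<in> L) \<and> (\<forall>xs. xs \<notin> tuples n L \<longrightarrow> br xs = 0) \<and>
     multilinear_map_on n L br \<and> skew_on n L br \<and>
     (\<forall>as\<in>tuples (n - 1) L. \<forall>bs\<in>tuples n L.
        br (as @ [br bs]) = (\<Sum>i<n. br (bs[i := br (as @ [bs ! i])])))"

definition filippov_algebroid ::
    "nat \<Rightarrow> ('m, 'e::real_vector) vbundle \<Rightarrow> (('m \<Rightarrow> 'e) list \<Rightarrow> 'm \<Rightarrow> 'e)
      \<Rightarrow> ('m \<Rightarrow> 'e list \<Rightarrow> ('m \<Rightarrow> real) \<Rightarrow> real) \<Rightarrow> bool" where
  "filippov_algebroid n A br a \<longleftrightarrow>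
     vector_bundle A \<and> filippov_algebra n (sections A) br \<and> bundle_anchor n A a \<and>
     (\<forall>xs\<in>tuples (n - 1) (sections A). \<forall>ys\<in>tuples (n - 1) (sections A).
        vf_bracket (anchor_map A a xs) (anchor_map A a ys) =
          (\<Sum>i<n - 1. anchor_map A a (ys[i := br (xs @ [ys ! i])]))) \<and>
     (\<forall>xs\<in>tuples (n - 1) (sections A). \<forall>f\<in>smooth_functions A. \<forall>y\<in>sections A.
        br (xs @ [f \<odot> y]) = f \<odot> br (xs @ [y]) + vf_apply (anchor_map A a xs) f \<odot> y)"

section \<open>The complex in degrees one and two\<close>

definition Der0 :: "('m, 'e::real_vector) vbundle \<Rightarrow> (('m \<Rightarrow> 'e) \<Rightarrow> 'm \<Rightarrow> 'e) set" where
  "Der0 A =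
     {D \<in> linear_endos (sections A).
        \<exists>\<sigma>\<in>vector_fields A. \<forall>f\<in>smooth_functions A. \<forall>z\<in>sections A.
          D (f \<odot> z) = f \<odot> D z + vf_apply \<sigma> f \<odot> z}"

definition is_symbol ::
    "nat \<Rightarrow> ('m, 'e::real_vector) vbundle
      \<Rightarrow> (('m \<Rightarrow> 'e) list \<Rightarrow> 'm \<Rightarrow> ('m \<Rightarrow> real) \<Rightarrow> real) \<Rightarrow> bool" where
  "is_symbol n A \<sigma> \<longleftrightarrow>
     (\<forall>xs\<in>tuples (n - 1) (sections A). \<sigma> xs \<in> vector_fields A) \<and>
     multilinear_map_on (n - 1) (sections A) \<sigma> \<and> skew_on (n - 1) (sections A) \<sigma> \<and>
     (\<forall>xs\<in>tuples (n - 1) (sections A). \<forall>i<n - 1. \<forall>f\<in>smooth_functions A.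
        \<sigma> (xs[i := f \<odot> (xs ! i)]) = f \<odot> \<sigma> xs)"

definition Der1 :: "nat \<Rightarrow> ('m, 'e::real_vector) vbundle \<Rightarrow> (('m \<Rightarrow> 'e) list \<Rightarrow> 'm \<Rightarrow> 'e) set" where
  "Der1 n A =
     {D. (\<forall>xs\<in>tuples n (sections A). D xs \<in> sections A) \<and>
         (\<forall>xs. xs \<notin> tuples n (sections A) \<longrightarrow> D xs = 0) \<and>
         multilinear_map_on n (sections A) D \<and> skew_on n (sections A) D \<and>
         (\<exists>\<sigma>. is_symbol n A \<sigma> \<and>
           (\<forall>xs\<in>tuples (n - 1) (sections A). \<forall>f\<in>smooth_functions A. \<forall>z\<in>sections A.
              D (xs @ [f \<odot> z]) = f \<odot> D (xs @ [z]) + vf_apply (\<sigma> xs) f \<odot> z))}"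

definition circ11 ::
    "nat \<Rightarrow> ('s list \<Rightarrow> 's) \<Rightarrow> ('s list \<Rightarrow> 's) \<Rightarrow> 's list \<Rightarrow> 's list \<Rightarrow> 's \<Rightarrow> 's::real_vector" where
  "circ11 n D\<^sub>1 D\<^sub>2 X\<^sub>1 X\<^sub>2 z =
     (\<Sum>s<n - 1. D\<^sub>1 (X\<^sub>2[s := D\<^sub>2 (X\<^sub>1 @ [X\<^sub>2 ! s])] @ [z]))
     - D\<^sub>1 (X\<^sub>1 @ [D\<^sub>2 (X\<^sub>2 @ [z])]) + D\<^sub>1 (X\<^sub>2 @ [D\<^sub>2 (X\<^sub>1 @ [z])])"

definition bracket11 ::
    "nat \<Rightarrow> ('m, 'e::real_vector) vbundle \<Rightarrow> (('m \<Rightarrow> 'e) list \<Rightarrow> 'm \<Rightarrow> 'e)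
      \<Rightarrow> (('m \<Rightarrow> 'e) list \<Rightarrow> 'm \<Rightarrow> 'e)
      \<Rightarrow> ('m \<Rightarrow> 'e) list \<Rightarrow> ('m \<Rightarrow> 'e) list \<Rightarrow> ('m \<Rightarrow> 'e) \<Rightarrow> 'm \<Rightarrow> 'e" where
  "bracket11 n A D\<^sub>1 D\<^sub>2 = (\<lambda>X\<^sub>1 X\<^sub>2 z.
     if X\<^sub>1 \<in> tuples (n - 1) (sections A) \<and> X\<^sub>2 \<in> tuples (n - 1) (sections A) \<and> z \<in> sections A
     then - circ11 n D\<^sub>1 D\<^sub>2 X\<^sub>1 X\<^sub>2 z - circ11 n D\<^sub>2 D\<^sub>1 X\<^sub>1 X\<^sub>2 z else 0)"

definition bracket10 ::
    "nat \<Rightarrow> ('m, 'e::real_vector) vbundle \<Rightarrow> (('m \<Rightarrow> 'e) list \<Rightarrow> 'm \<Rightarrow> 'e)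
      \<Rightarrow> (('m \<Rightarrow> 'e) \<Rightarrow> 'm \<Rightarrow> 'e) \<Rightarrow> ('m \<Rightarrow> 'e) list \<Rightarrow> 'm \<Rightarrow> 'e" where
  "bracket10 n A D N = (\<lambda>xs.
     if xs \<in> tuples n (sections A) then (\<Sum>i<n. D (xs[i := N (xs ! i)])) - N (D xs) else 0)"

text \<open>
  The element $\varphi$ of $\mathrm{Der}^1(A)$ with $[\varphi,\varphi]=0$ that corresponds to a
  Filippov algebroid is its bracket. Below it is a parameter \<^term>\<open>\<phi>\<close>.
\<close>

definition cocycles2 ::
    "nat \<Rightarrow> ('m, 'e::real_vector) vbundle \<Rightarrow> (('m \<Rightarrow> 'e) list \<Rightarrow> 'm \<Rightarrow> 'e)
      \<Rightarrow> (('m \<Rightarrow> 'e) list \<Rightarrow> 'm \<Rightarrow> 'e) set" where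
  "cocycles2 n A \<phi> = {\<psi> \<in> Der1 n A. bracket11 n A \<phi> \<psi> = 0}"

definition cohomologous ::
    "nat \<Rightarrow> ('m, 'e::real_vector) vbundle \<Rightarrow> (('m \<Rightarrow> 'e) list \<Rightarrow> 'm \<Rightarrow> 'e)
      \<Rightarrow> ((('m \<Rightarrow> 'e) list \<Rightarrow> 'm \<Rightarrow> 'e) \<times> (('m \<Rightarrow> 'e) list \<Rightarrow> 'm \<Rightarrow> 'e)) set" where
  "cohomologous n A \<phi> =
     {(\<psi>, \<psi>'). \<psi> \<in> cocycles2 n A \<phi> \<and> \<psi>' \<in> cocycles2 n A \<phi> \<and> \<psi>' - \<psi> \<in> bracket10 n A \<phi> ` Der0 A}"

definition H2F ::
    "nat \<Rightarrow> ('m, 'e::real_vector) vbundle \<Rightarrow> (('m \<Rightarrow> 'e) list \<Rightarrow> 'm \<Rightarrow> 'e)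
      \<Rightarrow> (('m \<Rightarrow> 'e) list \<Rightarrow> 'm \<Rightarrow> 'e) set set" where
  "H2F n A \<phi> = cocycles2 n A \<phi> // cohomologous n A \<phi>"

section \<open>Deformations\<close>

text \<open>Congruence of polynomial families in \<^term>\<open>t\<close> modulo the \<^term>\<open>l\<close>-th power of \<^term>\<open>t\<close>.\<close>

definition cong_t :: "nat \<Rightarrow> (real \<Rightarrow> 'a::real_vector) \<Rightarrow> (real \<Rightarrow> 'a) \<Rightarrow> bool" where
  "cong_t l F G \<longleftrightarrow> (\<exists>K c. \<forall>t. F t - G t = (\<Sum>j=l..K. t ^ j *\<^sub>R c j))"

definition deformations ::
    "nat \<Rightarrow> nat \<Rightarrow> ('m, 'e::real_vector) vbundle \<Rightarrow> (('m \<Rightarrow> 'e) list \<Rightarrow> 'm \<Rightarrow> 'e)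
      \<Rightarrow> (real \<Rightarrow> ('m \<Rightarrow> 'e) list \<Rightarrow> 'm \<Rightarrow> 'e) set" where
  "deformations k n A \<phi> =
     {\<phi>\<^sub>t. (\<exists>\<psi>. (\<forall>i\<in>{1..k}. \<psi> i \<in> Der1 n A) \<and> \<phi>\<^sub>t = (\<lambda>t. \<phi> + (\<Sum>i=1..k. t ^ i *\<^sub>R \<psi> i))) \<and>
          cong_t (k + 1) (\<lambda>t. bracket11 n A (\<phi>\<^sub>t t) (\<phi>\<^sub>t t)) (\<lambda>t. 0)}"

text \<open>Families $\mathrm{Id} + \sum_{i=1}^k t^i \phi_i$ of linear maps on a linear subspace \<^term>\<open>S\<close>.\<close>

definition unipotent_families ::
    "nat \<Rightarrow> 'a::real_vector set \<Rightarrow> (real \<Rightarrow> 'a \<Rightarrow> 'a) set" where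
  "unipotent_families k S =
     {F. \<exists>c. (\<forall>i\<in>{1..k}. c i \<in> linear_endos S) \<and>
         F = (\<lambda>t x. if x \<in> S then x + (\<Sum>i=1..k. t ^ i *\<^sub>R c i x) else 0)}"

text \<open>
  A vector bundle automorphism acts on sections by a linear bijection that is semilinear over
  the automorphism of the algebra of smooth functions given by the diffeomorphism of the base.
  A family $\Phi_t = \mathrm{Id} + \sum_{i=1}^k t^i \phi_i$ of linear maps is an automorphism of
  \<^term>\<open>A\<close> modulo $t^{k+1}$ if the same holds modulo $t^{k+1}$. The base is allowed
  to move: with \<^term>\<open>k = 1\<close> the maps $\phi_1$ obtained are derivations of \<^term>\<open>A\<close> with
  arbitrary symbol; requiring \<^term>\<open>\<alpha>\<close> to be the identity would leave only those of symbol 0.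
  Bijectivity modulo $t^{k+1}$ is automatic for families of this form.
\<close>

definition automorphism_families ::
    "nat \<Rightarrow> ('m, 'e::real_vector) vbundle \<Rightarrow> (real \<Rightarrow> ('m \<Rightarrow> 'e) \<Rightarrow> 'm \<Rightarrow> 'e) set" where
  "automorphism_families k A =
     {\<Phi> \<in> unipotent_families k (sections A).
        \<exists>\<alpha>\<in>unipotent_families k (smooth_functions A).
          (\<forall>f\<in>smooth_functions A. \<forall>g\<in>smooth_functions A.
             cong_t (k + 1) (\<lambda>t. \<alpha> t (f * g)) (\<lambda>t. \<alpha> t f * \<alpha> t g)) \<and>
          (\<forall>f\<in>smooth_functions A. \<forall>z\<in>sections A.
             cong_t (k + 1) (\<lambda>t. \<Phi> t (f \<odot> z)) (\<lambda>t. \<alpha> t f \<odot> \<Phi> t z))}"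

text \<open>\<^term>\<open>\<Psi>\<close> is the inverse of \<^term>\<open>\<Phi>\<close> modulo $t^{k+1}$.\<close>

definition inverse_mod ::
    "nat \<Rightarrow> 'a::real_vector set \<Rightarrow> (real \<Rightarrow> 'a \<Rightarrow> 'a) \<Rightarrow> (real \<Rightarrow> 'a \<Rightarrow> 'a) \<Rightarrow> bool" where
  "inverse_mod k S \<Phi> \<Psi> \<longleftrightarrow>
     \<Psi> \<in> unipotent_families k S \<and>
     (\<forall>x\<in>S. cong_t (k + 1) (\<lambda>t. \<Psi> t (\<Phi> t x)) (\<lambda>t. x) \<and>
            cong_t (k + 1) (\<lambda>t. \<Phi> t (\<Psi> t x)) (\<lambda>t. x))"

definition equivalent_deformations ::
    "nat \<Rightarrow> nat \<Rightarrow> ('m, 'e::real_vector) vbundle \<Rightarrow> (('m \<Rightarrow> 'e) list \<Rightarrow> 'm \<Rightarrow> 'e)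
      \<Rightarrow> ((real \<Rightarrow> ('m \<Rightarrow> 'e) list \<Rightarrow> 'm \<Rightarrow> 'e) \<times> (real \<Rightarrow> ('m \<Rightarrow> 'e) list \<Rightarrow> 'm \<Rightarrow> 'e)) set" where
  "equivalent_deformations k n A \<phi> =
     {(\<phi>\<^sub>t, \<phi>\<^sub>t'). \<phi>\<^sub>t \<in> deformations k n A \<phi> \<and> \<phi>\<^sub>t' \<in> deformations k n A \<phi> \<and>
        (\<exists>\<Phi>\<in>automorphism_families k A. \<exists>\<Psi>. inverse_mod k (sections A) \<Phi> \<Psi> \<and>
           (\<forall>xs\<in>tuples n (sections A).
              cong_t (k + 1) (\<lambda>t. \<phi>\<^sub>t' t xs) (\<lambda>t. \<Psi> t (\<phi>\<^sub>t t (map (\<Phi> t) xs)))))}"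

abbreviation infinitesimal_deformations where
  "infinitesimal_deformations \<equiv> deformations 1"

definition infinitesimal_deformation_classes ::
    "nat \<Rightarrow> ('m, 'e::real_vector) vbundle \<Rightarrow> (('m \<Rightarrow> 'e) list \<Rightarrow> 'm \<Rightarrow> 'e)
      \<Rightarrow> (real \<Rightarrow> ('m \<Rightarrow> 'e) list \<Rightarrow> 'm \<Rightarrow> 'e) set set" where
  "infinitesimal_deformation_classes n A \<phi> =
     infinitesimal_deformations n A \<phi> // equivalent_deformations 1 n A \<phi>"

end

theory Submission
  imports Defs
begin

text \<open>
  Modulo $t^2$, the equation $[\varphi + t\psi, \varphi + t\psi] = 0$ says that
  $[\varphi,\psi] = 0$, so $\psi \mapsto \varphi + t\psi$ is a bijection from cocycles to
  infinitesimal deformations. Conjugating by $\mathrm{Id} + tN$ with inverse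
  $\mathrm{Id} - tN$ replaces $\psi$ by $\psi + [\varphi, N]$, and
  $\mathrm{Id} + tN$ is an automorphism of \<open>A\<close> modulo $t^2$ precisely when $N$ is a
  derivation of \<open>A\<close>. So two cocycles are cohomologous precisely when the corresponding
  deformations are equivalent.
\<close>

section \<open>Polynomial families\<close>

text \<open>A congruence modulo t^2 says only that some polynomial in t, with coefficients in an
  arbitrary real vector space, expresses the difference. Each passage from a congruence back to an
  equation (deformation to cocycle, automorphism to derivation, equivalence to coboundary) rests on
  uniqueness of these coefficients. No topology on the coefficients is assumed, so uniqueness is
  proved by rescaling t instead of by limits. The convention that operators vanish off their domain
  creates a second obstacle: Id + tN has its formula at \<open>f \<odot> z\<close> only once
  \<open>f \<odot> z\<close> is known to be a section. Smoothness is defined by iterated partial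
  derivatives in charts, so this calls for the product rule for functions of class C^k. In return,
  maps that agree on their domain are equal, which makes inverses and coboundaries unique as
  functions.\<close>

lemma polynomial_family_eq_0:
  fixes a :: "nat \<Rightarrow> 'a::real_vector"
  assumes "\<And>t::real. (\<Sum>j<K. t ^ j *\<^sub>R a j) = 0" and "j < K"
  shows "a j = 0"
  using assms
proof (induction K arbitrary: a j)
  case 0
  then show ?case by simp
next
  case (Suc K)
  \<comment> \<open>\<open>P(2t) - 2\<^sup>K P(t)\<close> has no term of degree \<open>K\<close>.\<close>
  have "((2 ^ i - 2 ^ K) :: real) *\<^sub>R a i = 0" if "i < K" for i
  proof (rule Suc.IH[OF _ that])
    fix t :: real
    have "(\<Sum>j<K. t ^ j *\<^sub>R (2 ^ j - 2 ^ K) *\<^sub>R a j) =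
        (\<Sum>j<Suc K. (2 * t) ^ j *\<^sub>R a j) - 2 ^ K *\<^sub>R (\<Sum>j<Suc K. t ^ j *\<^sub>R a j)"
      by (simp add: sum_subtractf scaleR_sum_right power_mult_distrib algebra_simps)
    then show "(\<Sum>j<K. t ^ j *\<^sub>R (2 ^ j - 2 ^ K) *\<^sub>R a j) = 0"
      using Suc.prems(1) by (simp only: scaleR_zero_right diff_zero)
  qed
  moreover have "(2 ^ i - 2 ^ K :: real) \<noteq> 0" if "i < K" for i
    using that by simp
  ultimately have low: "a i = 0" if "i < K" for i
    using that scaleR_eq_0_iff by blast
  moreover have "a K = 0"
    using Suc.prems(1)[of 1] low by simp
  ultimately show ?case
    using Suc.prems(2) by (auto simp: less_Suc_eq)
qed

text \<open>Coefficients indexed from 0, with the low ones zero, do not tie the summation range to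
  \<open>l\<close>. Sums of different length can then be padded, and
  \<open>polynomial_family_eq_0\<close> becomes applicable.\<close>

lemma cong_t_iff_lessThan:
  "cong_t l F G \<longleftrightarrow> (\<exists>K c. (\<forall>j<l. c j = 0) \<and> (\<forall>t. F t - G t = (\<Sum>j<K. t ^ j *\<^sub>R c j)))"
proof
  assume "cong_t l F G"
  then obtain K c where *: "\<And>t. F t - G t = (\<Sum>j=l..K. t ^ j *\<^sub>R c j)"
    unfolding cong_t_def by blast
  have "F t - G t = (\<Sum>j<Suc K. t ^ j *\<^sub>R (if j < l then 0 else c j))" for t
    unfolding * by (rule sum.mono_neutral_cong_left) auto
  then show "\<exists>K c. (\<forall>j<l. c j = 0) \<and> (\<forall>t. F t - G t = (\<Sum>j<K. t ^ j *\<^sub>R c j))"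
    by (intro exI[of _ "Suc K"] exI[of _ "\<lambda>j. if j < l then 0 else c j"]) simp
next
  assume "\<exists>K c. (\<forall>j<l. c j = 0) \<and> (\<forall>t. F t - G t = (\<Sum>j<K. t ^ j *\<^sub>R c j))"
  then obtain K c where low: "\<And>j. j < l \<Longrightarrow> c j = 0"
    and *: "\<And>t. F t - G t = (\<Sum>j<K. t ^ j *\<^sub>R c j)"
    by blast
  have "F t - G t = (\<Sum>j=l..K. t ^ j *\<^sub>R (if j < K then c j else 0))" for t
    unfolding * by (rule sum.mono_neutral_cong) (auto simp: low)
  then show "cong_t l F G"
    unfolding cong_t_def by (intro exI[of _ K] exI[of _ "\<lambda>j. if j < K then c j else 0"]) simp
qed

lemma cong_t_refl: "cong_t l F F"
  unfolding cong_t_iff_lessThan by (intro exI[of _ 0]) auto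

lemma cong_t_add:
  assumes "cong_t l F G" and "cong_t l F' G'"
  shows "cong_t l (\<lambda>t. F t + F' t) (\<lambda>t. G t + G' t)"
proof -
  obtain K c where c: "\<And>j. j < l \<Longrightarrow> c j = 0" "\<And>t. F t - G t = (\<Sum>j<K. t ^ j *\<^sub>R c j)"
    using assms(1) unfolding cong_t_iff_lessThan by blast
  obtain K' c' where c': "\<And>j. j < l \<Longrightarrow> c' j = 0" "\<And>t. F' t - G' t = (\<Sum>j<K'. t ^ j *\<^sub>R c' j)"
    using assms(2) unfolding cong_t_iff_lessThan by blast
  \<comment> \<open>The two sums may have different lengths; each coefficient family is cut off at
    its own bound because nothing is known about it beyond.\<close>
  let ?d = "\<lambda>j. (if j < K then c j else 0) + (if j < K' then c' j else 0)"
  have "F t + F' t - (G t + G' t) = (\<Sum>j<max K K'. t ^ j *\<^sub>R ?d j)" for t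
  proof -
    have "F t - G t = (\<Sum>j<max K K'. t ^ j *\<^sub>R (if j < K then c j else 0))"
      unfolding c(2) by (rule sum.mono_neutral_cong_left) auto
    moreover have "F' t - G' t = (\<Sum>j<max K K'. t ^ j *\<^sub>R (if j < K' then c' j else 0))"
      unfolding c'(2) by (rule sum.mono_neutral_cong_left) auto
    ultimately show ?thesis
      by (simp add: scaleR_add_right sum.distrib algebra_simps)
  qed
  then show ?thesis
    unfolding cong_t_iff_lessThan
    by (intro exI[of _ "max K K'"] exI[of _ ?d]) (simp add: c(1) c'(1))
qed

lemma cong_t_uminus:
  assumes "cong_t l F G"
  shows "cong_t l (\<lambda>t. - F t) (\<lambda>t. - G t)"
proof -
  obtain K c where c: "\<And>j. j < l \<Longrightarrow> c j = 0" "\<And>t. F t - G t = (\<Sum>j<K. t ^ j *\<^sub>R c j)"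
    using assms unfolding cong_t_iff_lessThan by blast
  have "- F t - - G t = (\<Sum>j<K. t ^ j *\<^sub>R - c j)" for t
    using c(2)[of t] by (simp add: sum_negf algebra_simps)
  then show ?thesis
    unfolding cong_t_iff_lessThan by (intro exI[of _ K] exI[of _ "\<lambda>j. - c j"]) (simp add: c(1))
qed

lemma cong_t_sym: "cong_t l F G \<Longrightarrow> cong_t l G F"
  using cong_t_uminus[of l F G] by (simp add: cong_t_def)

text \<open>Only the difference of the two families matters, and G cancels from (F + G) - (G +
  H).\<close>

lemma cong_t_trans:
  assumes "cong_t l F G" and "cong_t l G H"
  shows "cong_t l F H"
  using cong_t_add[OF assms] by (simp add: cong_t_def)

text \<open>Shifting the coefficients by one index gains one order: whatever stands behind a factor
  t has to be known only to one order less.\<close>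

lemma cong_t_mult_t:
  assumes "cong_t l F G"
  shows "cong_t (Suc l) (\<lambda>t. t *\<^sub>R F t) (\<lambda>t. t *\<^sub>R G t)"
proof -
  obtain K c where c: "\<And>j. j < l \<Longrightarrow> c j = 0" "\<And>t. F t - G t = (\<Sum>j<K. t ^ j *\<^sub>R c j)"
    using assms unfolding cong_t_iff_lessThan by blast
  let ?d = "\<lambda>j. case j of 0 \<Rightarrow> 0 | Suc i \<Rightarrow> c i"
  have "t *\<^sub>R F t - t *\<^sub>R G t = (\<Sum>j<Suc K. t ^ j *\<^sub>R ?d j)" for t
    unfolding sum.lessThan_Suc_shift
    by (simp add: c(2) scaleR_sum_right flip: scaleR_diff_right)
  then show ?thesis
    unfolding cong_t_iff_lessThan
    by (intro exI[of _ "Suc K"] exI[of _ ?d]) (simp add: c(1) split: nat.split)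
qed

lemma cong_t_mono:
  assumes "cong_t k F G" and "l \<le> k"
  shows "cong_t l F G"
  using assms unfolding cong_t_iff_lessThan by (meson less_le_trans)

lemma cong_t_affine_iff:
  fixes u v u' v' :: "'a::real_vector"
  shows "cong_t 2 (\<lambda>t. u + t *\<^sub>R v) (\<lambda>t. u' + t *\<^sub>R v') \<longleftrightarrow> u = u' \<and> v = v'"
proof
  assume "cong_t 2 (\<lambda>t. u + t *\<^sub>R v) (\<lambda>t. u' + t *\<^sub>R v')"
  then obtain K c where c: "\<And>j. j < 2 \<Longrightarrow> c j = 0"
      "\<And>t. u + t *\<^sub>R v - (u' + t *\<^sub>R v') = (\<Sum>j<K. t ^ j *\<^sub>R c j)"
    unfolding cong_t_iff_lessThan by blast
  \<comment> \<open>These are the coefficients of the left side minus the right side. Summing up to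
    \<open>Suc (Suc K)\<close> keeps the indices 0 and 1 in range even when \<open>K\<close> is less
    than 2.\<close>
  define d where "d = (\<lambda>j. if j = 0 then u - u' else if j = 1 then v - v'
      else if j < K then - c j else 0)"
  have "(\<Sum>j<Suc (Suc K). t ^ j *\<^sub>R d j) = 0" for t
  proof -
    have "(\<Sum>j<K. t ^ j *\<^sub>R c j) =
        (\<Sum>j<Suc (Suc K). t ^ j *\<^sub>R (if j < K \<and> 2 \<le> j then c j else 0))"
      by (rule sum.mono_neutral_cong_left) (auto simp: c(1))
    also have "\<dots> = (\<Sum>j<K. t ^ Suc (Suc j) *\<^sub>R (if Suc (Suc j) < K then c (Suc (Suc j)) else 0))"
      unfolding sum.lessThan_Suc_shift by simp
    also have "\<dots> = - (\<Sum>j<K. t ^ Suc (Suc j) *\<^sub>R d (Suc (Suc j)))"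
      unfolding sum_negf[symmetric] by (rule sum.cong) (auto simp: d_def)
    finally have "u + t *\<^sub>R v - (u' + t *\<^sub>R v') +
        (\<Sum>j<K. t ^ Suc (Suc j) *\<^sub>R d (Suc (Suc j))) = 0"
      by (simp add: c(2))
    then show ?thesis
      unfolding sum.lessThan_Suc_shift by (simp add: d_def algebra_simps)
  qed
  from polynomial_family_eq_0[OF this, of 0] polynomial_family_eq_0[OF this, of 1]
  show "u = u' \<and> v = v'" by (simp add: d_def)
qed (simp add: cong_t_refl)

lemma cong_t_square: "cong_t 2 (\<lambda>t. t\<^sup>2 *\<^sub>R w) (\<lambda>t. 0)"
  unfolding cong_t_def by (intro exI[of _ 2] exI[of _ "\<lambda>_. w"]) simp

lemma cong_t_quadratic: "cong_t 2 (\<lambda>t. u + t *\<^sub>R v + t\<^sup>2 *\<^sub>R w) (\<lambda>t. u + t *\<^sub>R v)"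
  using cong_t_add[OF cong_t_refl cong_t_square] by simp

text \<open>A bilinear expression in two affine families is exactly quadratic in t, so this form
  turns such congruences directly into equations between coefficients.\<close>

lemma cong_t_quadratic_iff:
  "cong_t 2 (\<lambda>t. u + t *\<^sub>R v + t\<^sup>2 *\<^sub>R w) (\<lambda>t. u' + t *\<^sub>R v' + t\<^sup>2 *\<^sub>R w') \<longleftrightarrow> u = u' \<and> v = v'"
    (is "cong_t 2 ?F ?G \<longleftrightarrow> _")
proof -
  have "cong_t 2 ?F ?G \<longleftrightarrow> cong_t 2 (\<lambda>t. u + t *\<^sub>R v) (\<lambda>t. u' + t *\<^sub>R v')"
    using cong_t_quadratic[of u v w] cong_t_quadratic[of u' v' w']
    by (blast intro: cong_t_sym cong_t_trans)
  then show ?thesis by (simp only: cong_t_affine_iff)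
qed

section \<open>Expansion of multilinear maps\<close>

lemma tuples_update: "xs \<in> tuples k S \<Longrightarrow> x \<in> S \<Longrightarrow> xs[i := x] \<in> tuples k S"
  unfolding tuples_def using set_update_subset_insert[of xs i x] by auto

lemma tuples_nth: "xs \<in> tuples k S \<Longrightarrow> i < k \<Longrightarrow> xs ! i \<in> S"
  unfolding tuples_def by (auto simp: subset_iff)

text \<open>The bound on \<open>n\<close> guards against truncated subtraction: for n = 0 the list
  would have length 1.\<close>

lemma tuples_snoc:
  "X \<in> tuples (n - 1) S \<Longrightarrow> z \<in> S \<Longrightarrow> 1 \<le> n \<Longrightarrow> X @ [z] \<in> tuples n S"
  unfolding tuples_def by auto

lemma multilinear_update_add:
  assumes "multilinear_map_on k S F" "xs \<in> tuples k S" "i < k" "x \<in> S" "y \<in> S"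
  shows "F (xs[i := x + y]) = F (xs[i := x]) + F (xs[i := y])"
  using assms unfolding multilinear_map_on_def linear_map_on_def by blast

lemma multilinear_update_scaleR:
  assumes "multilinear_map_on k S F" "xs \<in> tuples k S" "i < k" "x \<in> S"
  shows "F (xs[i := c *\<^sub>R x]) = c *\<^sub>R F (xs[i := x])"
  using assms unfolding multilinear_map_on_def linear_map_on_def by blast

text \<open>The slots are perturbed one at a time. Linearity in slot m splits off a term with a
  factor t, whose own expansion matters only through its constant term.\<close>

lemma multilinear_expand_slots:
  assumes S: "subspace S" and F: "multilinear_map_on k S F" and c: "\<And>x. x \<in> S \<Longrightarrow> c x \<in> S"
    and xs: "xs \<in> tuples k S" and "m \<le> k"
  shows "cong_t 2 (\<lambda>t. F (map (\<lambda>x. x + t *\<^sub>R c x) (take m xs) @ drop m xs))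
           (\<lambda>t. F xs + t *\<^sub>R (\<Sum>i<m. F (xs[i := c (xs ! i)])))"
  using \<open>m \<le> k\<close> xs
proof (induction m arbitrary: xs)
  case 0
  then show ?case by (simp add: cong_t_refl)
next
  case (Suc m)
  let ?G = "\<lambda>m xs t. map (\<lambda>x. x + t *\<^sub>R c x) (take m xs) @ drop m xs"
  have len: "length xs = k" and m: "m < k"
    using Suc.prems by (auto simp: tuples_def)
  have xm: "xs ! m \<in> S"
    using Suc.prems(2) m by (rule tuples_nth)
  have upd: "xs[m := c (xs ! m)] \<in> tuples k S"
    using Suc.prems(2) c[OF xm] by (rule tuples_update)
  have G_in: "?G m xs t \<in> tuples k S" for t
  proof -
    have "set xs \<subseteq> S" using Suc.prems(2) by (simp add: tuples_def)
    then have "x + t *\<^sub>R c x \<in> S" if "x \<in> set (take m xs)" for x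
      using that c S by (meson in_set_takeD subsetD subspace_add subspace_scale)
    then show ?thesis
      using \<open>set xs \<subseteq> S\<close> len m by (auto simp: tuples_def dest: in_set_dropD)
  qed
  \<comment> \<open>Slot m lies in the part not yet perturbed, so updating it commutes with
    perturbing the first m entries.\<close>
  have G_upd: "(?G m xs t)[m := y] = ?G m (xs[m := y]) t" for t y
    using len m by (simp add: list_update_append drop_update_swap)
  have G_Suc: "?G (Suc m) xs t = (?G m xs t)[m := xs ! m + t *\<^sub>R c (xs ! m)]" for t
    using len m
    by (simp add: take_Suc_conv_app_nth list_update_append flip: Cons_nth_drop_Suc)
  have split: "F (?G (Suc m) xs t) = F (?G m xs t) + t *\<^sub>R F (?G m (xs[m := c (xs ! m)]) t)" for t
  proof -
    have "F (?G (Suc m) xs t) = F ((?G m xs t)[m := xs ! m]) + F ((?G m xs t)[m := t *\<^sub>R c (xs ! m)])"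
      unfolding G_Suc using xm c S
      by (intro multilinear_update_add[OF F G_in m]) (auto simp: subspace_scale)
    also have "F ((?G m xs t)[m := t *\<^sub>R c (xs ! m)]) = t *\<^sub>R F ((?G m xs t)[m := c (xs ! m)])"
      using xm c by (intro multilinear_update_scaleR[OF F G_in m])
    finally show ?thesis by (simp only: G_upd list_update_id)
  qed
  \<comment> \<open>The induction hypothesis is used a second time, for the list with slot m already
    replaced; this is why \<open>xs\<close> is generalised.\<close>
  have "cong_t 2 (\<lambda>t. F (?G m (xs[m := c (xs ! m)]) t)) (\<lambda>t. F (xs[m := c (xs ! m)]) +
      t *\<^sub>R (\<Sum>i<m. F ((xs[m := c (xs ! m)])[i := c ((xs[m := c (xs ! m)]) ! i)])))"
    using Suc.prems upd by (intro Suc.IH) auto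
  \<comment> \<open>The factor t moves the linear term of this expansion to t^2, where it is
    discarded.\<close>
  from cong_t_mono[OF cong_t_mult_t[OF this], of 2]
  have "cong_t 2 (\<lambda>t. t *\<^sub>R F (?G m (xs[m := c (xs ! m)]) t)) (\<lambda>t. t *\<^sub>R F (xs[m := c (xs ! m)]) +
      t\<^sup>2 *\<^sub>R (\<Sum>i<m. F ((xs[m := c (xs ! m)])[i := c ((xs[m := c (xs ! m)]) ! i)])))"
    by (simp add: scaleR_add_right power2_eq_square)
  then have "cong_t 2 (\<lambda>t. t *\<^sub>R F (?G m (xs[m := c (xs ! m)]) t)) (\<lambda>t. t *\<^sub>R F (xs[m := c (xs ! m)]))"
    using cong_t_quadratic[of 0] by (elim cong_t_trans) simp
  from cong_t_add[OF Suc.IH this] Suc.prems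
  show ?case
    by (simp add: split scaleR_add_right algebra_simps)
qed

lemma multilinear_expand:
  assumes "subspace S" "multilinear_map_on k S F" "\<And>x. x \<in> S \<Longrightarrow> c x \<in> S" "xs \<in> tuples k S"
  shows "cong_t 2 (\<lambda>t. F (map (\<lambda>x. x + t *\<^sub>R c x) xs))
           (\<lambda>t. F xs + t *\<^sub>R (\<Sum>i<k. F (xs[i := c (xs ! i)])))"
  using multilinear_expand_slots[OF assms order.refl] assms(4) by (simp add: tuples_def)

section \<open>Products of smooth functions\<close>

text \<open>For i < m the coordinate line through x stays inside the Euclidean space, so it meets
  \<open>W\<close> in a neighbourhood of x although \<open>W\<close> is open only relative to that
  space.\<close>

lemma eventually_fun_upd_in_open:
  assumes "openin (Euclidean_space m) W" "x \<in> W" "i < m"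
  shows "eventually (\<lambda>s. x(i := s) \<in> W) (nhds (x i))"
proof -
  have "x \<in> topspace (Euclidean_space m)"
    using assms by (meson openin_subset subsetD)
  then have "continuous_map euclideanreal (Euclidean_space m) (\<lambda>s. x(i := s))"
    using assms(3)
    by (auto simp: Euclidean_space_def continuous_map_in_subtopology continuous_map_componentwise_UNIV)
  then have "open {s. x(i := s) \<in> W}"
    using openin_continuous_map_preimage[OF _ assms(1)] by fastforce
  then show ?thesis
    using assms(2) unfolding eventually_nhds by fastforce
qed

text \<open>Near x i the coordinate line lies in \<open>W\<close>, so a partial derivative at a
  point of \<open>W\<close> sees only values on \<open>W\<close>. The rules for sums and products
  identify partial derivatives on \<open>W\<close> only, and this lemma makes that
  sufficient.\<close>

lemma C_k_on_eq:
  assumes W: "openin (Euclidean_space m) W"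
    and "\<And>x. x \<in> W \<Longrightarrow> f x = g x" and "C_k_on m W k f"
  shows "C_k_on m W k g"
  using assms(2,3)
proof (induction k arbitrary: f g)
  case 0
  then show ?case by (auto elim: continuous_map_eq)
next
  case (Suc k)
  have ev: "eventually (\<lambda>s. f (x(i := s)) = g (x(i := s))) (nhds (x i))" if "x \<in> W" "i < m" for x i
    using eventually_fun_upd_in_open[OF W that] by (rule eventually_mono) (rule Suc.prems(1))
  have diff: "(\<lambda>s. g (x(i := s))) differentiable (at (x i))" if "x \<in> W" "i < m" for x i
    using Suc.prems(2) that DERIV_cong_ev[OF refl ev[OF that] refl]
    by (simp add: real_differentiable_def) blast
  have "partial_deriv i f x = partial_deriv i g x" if "x \<in> W" "i < m" for x i
    unfolding partial_deriv_def using ev[OF that] by (rule deriv_cong_ev) simp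
  then have "C_k_on m W k (partial_deriv i g)" if "i < m" for i
    using Suc.IH[of "partial_deriv i f"] Suc.prems(2) that by simp
  moreover have "continuous_map (subtopology (Euclidean_space m) W) euclideanreal g"
    using Suc.prems by (auto elim: continuous_map_eq)
  ultimately show ?case
    using diff by simp
qed

lemma C_k_on_subset:
  assumes "C_k_on m W k f" and "V \<subseteq> W"
  shows "C_k_on m V k f"
  using assms
  by (induction k arbitrary: f) (auto elim: continuous_map_from_subtopology_mono)

lemma C_k_on_SucD: "C_k_on m W (Suc k) f \<Longrightarrow> C_k_on m W k f"
  by (induction k arbitrary: f) auto

lemma C_k_on_partial_derivative:
  assumes "C_k_on m W (Suc k) f" "x \<in> W" "i < m"
  shows "((\<lambda>s. f (x(i := s))) has_real_derivative partial_deriv i f x) (at (x i))"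
  using assms by (simp add: partial_deriv_def DERIV_deriv_iff_real_differentiable)

lemma C_k_on_add:
  assumes W: "openin (Euclidean_space m) W" and "C_k_on m W k f" and "C_k_on m W k g"
  shows "C_k_on m W k (\<lambda>x. f x + g x)"
  using assms(2,3)
proof (induction k arbitrary: f g)
  case 0
  then show ?case by (auto intro: continuous_map_add)
next
  case (Suc k)
  have D: "((\<lambda>s. f (x(i := s)) + g (x(i := s))) has_real_derivative
      partial_deriv i f x + partial_deriv i g x) (at (x i))" if "x \<in> W" "i < m" for x i
    using Suc.prems that by (intro DERIV_add C_k_on_partial_derivative)
  have "C_k_on m W k (partial_deriv i (\<lambda>x. f x + g x))" if "i < m" for i
  proof (rule C_k_on_eq[OF W])
    show "C_k_on m W k (\<lambda>x. partial_deriv i f x + partial_deriv i g x)"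
      using Suc that by simp
    show "partial_deriv i f x + partial_deriv i g x = partial_deriv i (\<lambda>x. f x + g x) x"
      if "x \<in> W" for x
      using DERIV_imp_deriv[OF D[OF that \<open>i < m\<close>]] by (simp add: partial_deriv_def)
  qed
  then show ?case
    using Suc.prems D by (auto intro: continuous_map_add simp: real_differentiable_def)
qed

text \<open>Each partial derivative is a sum of products of a partial derivative with an
  undifferentiated factor. The induction hypothesis covers these products once that factor is
  lowered to class C^k.\<close>

lemma C_k_on_mult:
  assumes W: "openin (Euclidean_space m) W" and "C_k_on m W k f" and "C_k_on m W k g"
  shows "C_k_on m W k (\<lambda>x. f x * g x)"
  using assms(2,3)
proof (induction k arbitrary: f g)
  case 0
  then show ?case by (auto intro: continuous_map_real_mult)
next
  case (Suc k)
  have D: "((\<lambda>s. f (x(i := s)) * g (x(i := s))) has_real_derivative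
      partial_deriv i f x * g x + partial_deriv i g x * f x) (at (x i))"
    if "x \<in> W" "i < m" for x i
    using DERIV_mult[OF C_k_on_partial_derivative[OF Suc.prems(1) that]
        C_k_on_partial_derivative[OF Suc.prems(2) that]] by (simp only: fun_upd_triv)
  have "C_k_on m W k (partial_deriv i (\<lambda>x. f x * g x))" if "i < m" for i
  proof (rule C_k_on_eq[OF W])
    show "C_k_on m W k (\<lambda>x. partial_deriv i f x * g x + partial_deriv i g x * f x)"
      using Suc.prems that C_k_on_SucD[OF Suc.prems(1)] C_k_on_SucD[OF Suc.prems(2)]
      by (intro C_k_on_add[OF W] Suc.IH) simp_all
    show "partial_deriv i f x * g x + partial_deriv i g x * f x =
        partial_deriv i (\<lambda>x. f x * g x) x" if "x \<in> W" for x
      using DERIV_imp_deriv[OF D[OF that \<open>i < m\<close>]] by (simp add: partial_deriv_def)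
  qed
  then show ?case
    using Suc.prems D by (auto intro: continuous_map_real_mult simp: real_differentiable_def)
qed

text \<open>A chart is a homeomorphism onto an open set, hence carries open sets to open sets. This
  supplies the open domains that the calculus in coordinates requires, and injectivity lets
  \<open>inv_into V c\<close> undo \<open>c\<close>.\<close>

lemma smooth_manifold_chart:
  assumes "smooth_manifold M" "(V, c) \<in> atlas M" "openin (mtop M) U"
  shows "openin (Euclidean_space (mdim M)) (c ` (U \<inter> V))" and "inj_on c V"
proof -
  have V: "openin (mtop M) V" "openin (Euclidean_space (mdim M)) (c ` V)"
    and hom: "homeomorphic_map (subtopology (mtop M) V)
      (subtopology (Euclidean_space (mdim M)) (c ` V)) c"
    using assms(1,2) unfolding smooth_manifold_def by auto
  have VM: "V \<subseteq> points M"
    using V(1) by (rule openin_subset)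
  have "openin (subtopology (mtop M) V) (U \<inter> V)"
    using assms(3) by (rule openin_subtopology_Int)
  then have "openin (subtopology (Euclidean_space (mdim M)) (c ` V)) (c ` (U \<inter> V))"
    using homeomorphic_map_openness_eq[OF hom] by blast
  then show "openin (Euclidean_space (mdim M)) (c ` (U \<inter> V))"
    using V(2) by (rule openin_trans_full)
  show "inj_on c V"
    using homeomorphic_imp_injective_map[OF hom] VM by (simp add: Int_absorb1)
qed

lemma smooth_on_mult:
  assumes "smooth_manifold M" "openin (mtop M) U" "smooth_on M U f" "smooth_on M U g"
  shows "smooth_on M U (\<lambda>p. f p * g p)"
  using assms smooth_manifold_chart(1)[OF assms(1) _ assms(2)]
  unfolding smooth_on_def C_inf_on_def by (auto 4 4 intro!: C_k_on_mult)

lemma smooth_on_eq: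
  assumes M: "smooth_manifold M" and U: "openin (mtop M) U" and f: "smooth_on M U f"
    and eq: "\<And>p. p \<in> U \<Longrightarrow> f p = g p"
  shows "smooth_on M U g"
  unfolding smooth_on_def C_inf_on_def
proof clarify
  fix V c k
  assume Vc: "(V, c) \<in> atlas M"
  show "C_k_on (mdim M) (c ` (U \<inter> V)) k (\<lambda>x. g (inv_into V c x))"
  proof (rule C_k_on_eq[OF smooth_manifold_chart(1)[OF M Vc U]])
    show "C_k_on (mdim M) (c ` (U \<inter> V)) k (\<lambda>x. f (inv_into V c x))"
      using f Vc unfolding smooth_on_def C_inf_on_def by auto
    show "f (inv_into V c x) = g (inv_into V c x)" if "x \<in> c ` (U \<inter> V)" for x
      using that smooth_manifold_chart(2)[OF M Vc U] eq by auto
  qed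
qed

lemma smooth_on_subset: "smooth_on M U f \<Longrightarrow> V \<subseteq> U \<Longrightarrow> smooth_on M V f"
  unfolding smooth_on_def C_inf_on_def by (fast intro: C_k_on_subset)

lemma smooth_functions_mult:
  assumes "smooth_manifold M" "f \<in> smooth_functions M" "g \<in> smooth_functions M"
  shows "f * g \<in> smooth_functions M"
  using assms smooth_on_mult[OF assms(1) openin_topspace, of f g]
  by (simp add: smooth_functions_def times_fun_def)

text \<open>By linearity of \<tau> p on the fibre, the coordinates of \<open>f \<odot> z\<close>
  over a trivialising set are f times those of z. This holds only over that set, whence the use of
  \<open>smooth_on_eq\<close>.\<close>

lemma sections_fmult:
  assumes A: "vector_bundle A" and f: "f \<in> smooth_functions A" and z: "z \<in> sections A"
  shows "f \<odot> z \<in> sections A"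
proof -
  have M: "smooth_manifold A"
    using A by (simp add: vector_bundle_def)
  have "smooth_on A U (\<lambda>p. \<tau> p ((f \<odot> z) p) i)" if U: "(U, \<tau>) \<in> trivs A" and "i < rank A" for U \<tau> i
  proof (rule smooth_on_eq[OF M])
    show op: "openin (mtop A) U"
      using A U unfolding vector_bundle_def by fast
    then have UM: "U \<subseteq> points A" by (rule openin_subset)
    show "smooth_on A U (\<lambda>p. f p * \<tau> p (z p) i)"
      using f z that UM
      by (intro smooth_on_mult[OF M op])
        (auto simp: smooth_functions_def sections_def intro: smooth_on_subset)
    show "f p * \<tau> p (z p) i = \<tau> p ((f \<odot> z) p) i" if "p \<in> U" for p
    proof -
      have "linear_map_on (fibre A p) (\<tau> p)"
        using A U that unfolding vector_bundle_def by fast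
      moreover have "z p \<in> fibre A p"
        using z UM that by (auto simp: sections_def)
      ultimately show ?thesis
        by (simp add: linear_map_on_def fmult_def)
    qed
  qed
  moreover have "(f \<odot> z) p \<in> fibre A p" if "p \<in> points A" for p
    using A z that unfolding vector_bundle_def sections_def fmult_def
    by (auto intro: subspace_scale)
  ultimately show ?thesis
    using z by (auto simp: sections_def fmult_def)
qed

section \<open>Infinitesimal automorphisms\<close>

text \<open>This is Id + tc on \<open>S\<close>: a member of \<open>unipotent_families 1 S\<close>,
  with its coefficient sequence reduced to the one entry that counts.\<close>

definition unipotent :: "'a::real_vector set \<Rightarrow> ('a \<Rightarrow> 'a) \<Rightarrow> real \<Rightarrow> 'a \<Rightarrow> 'a" where
  "unipotent S c = (\<lambda>t x. if x \<in> S then x + t *\<^sub>R c x else 0)"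

lemma unipotent_families_1: "unipotent_families 1 S = unipotent S ` linear_endos S"
proof -
  have "(\<lambda>t x. if x \<in> S then x + (\<Sum>i=1..1. t ^ i *\<^sub>R c i x) else 0) = unipotent S (c 1)" for c
    by (simp add: unipotent_def cong: if_cong)
  then have "unipotent_families 1 S = {unipotent S (c (1::nat)) |c. c 1 \<in> linear_endos S}"
    by (auto simp only: unipotent_families_def atLeastAtMost_singleton ball_simps)
  also have "\<dots> = unipotent S ` linear_endos S"
    by (auto simp: image_iff intro: exI[of _ "\<lambda>_. c" for c])
  finally show ?thesis .
qed

lemma linear_endos_uminus: "subspace S \<Longrightarrow> c \<in> linear_endos S \<Longrightarrow> - c \<in> linear_endos S"
  by (simp add: linear_endos_def linear_map_on_def subspace_neg)

text \<open>The product of d and c enters only at order t^2, so modulo t^2 composition amounts to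
  adding the coefficients.\<close>

lemma unipotent_unipotent:
  assumes "subspace S" "c \<in> linear_endos S" "d \<in> linear_endos S" "x \<in> S"
  shows "unipotent S d t (unipotent S c t x) = x + t *\<^sub>R (c x + d x) + t\<^sup>2 *\<^sub>R d (c x)"
proof -
  have "c x \<in> S" using assms by (simp add: linear_endos_def)
  then have "t *\<^sub>R c x \<in> S" "x + t *\<^sub>R c x \<in> S"
    using assms by (simp_all add: subspace_add subspace_scale)
  moreover have "d (x + t *\<^sub>R c x) = d x + t *\<^sub>R d (c x)"
    using assms \<open>c x \<in> S\<close> \<open>t *\<^sub>R c x \<in> S\<close> by (simp add: linear_endos_def linear_map_on_def)
  ultimately show ?thesis
    using assms by (simp add: unipotent_def algebra_simps power2_eq_square)
qed

text \<open>Comparing coefficients of t forces c + d = 0 on \<open>S\<close>, and off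
  \<open>S\<close> both maps vanish. Uniqueness as a function later removes the quantifier over
  inverses.\<close>

lemma inverse_mod_1_iff:
  assumes S: "subspace S" and c: "c \<in> linear_endos S"
  shows "inverse_mod 1 S (unipotent S c) \<Psi> \<longleftrightarrow> \<Psi> = unipotent S (- c)"
proof
  assume "inverse_mod 1 S (unipotent S c) \<Psi>"
  then obtain d where d: "d \<in> linear_endos S" "\<Psi> = unipotent S d"
    and inv: "\<And>x. x \<in> S \<Longrightarrow> cong_t 2 (\<lambda>t. \<Psi> t (unipotent S c t x)) (\<lambda>t. x)"
    unfolding inverse_mod_def unipotent_families_1 one_add_one by blast
  have "d x = (- c) x" for x
  proof (cases "x \<in> S")
    case True
    from inv[OF this] have "c x + d x = 0"
      using cong_t_quadratic_iff[of x "c x + d x" "d (c x)" x 0 0]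
      by (simp add: d unipotent_unipotent S c True)
    then show ?thesis by (simp add: add_eq_0_iff)
  next
    case False
    then show ?thesis using c d by (simp add: linear_endos_def)
  qed
  then have "d = - c" by (rule ext)
  then show "\<Psi> = unipotent S (- c)" using d by simp
next
  assume \<Psi>: "\<Psi> = unipotent S (- c)"
  have mc: "- c \<in> linear_endos S"
    using assms by (rule linear_endos_uminus)
  \<comment> \<open>Stated for an arbitrary pair, this covers the composites in both orders.\<close>
  have "cong_t 2 (\<lambda>t. unipotent S d t (unipotent S e t x)) (\<lambda>t. x)"
    if "x \<in> S" "d \<in> linear_endos S" "e \<in> linear_endos S" "e x + d x = 0" for d e x
    using cong_t_quadratic[of x 0 "d (e x)"] that by (simp add: unipotent_unipotent S)
  then show "inverse_mod 1 S (unipotent S c) \<Psi>"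
    using c mc unfolding inverse_mod_def unipotent_families_1 one_add_one \<Psi> by simp
qed

text \<open>The coefficient of \<open>t\<close> in the family \<open>\<alpha>\<close> of algebra automorphisms is a derivation of the
  smooth functions, that is, a vector field; it is the symbol of the coefficient of \<open>t\<close>
  in \<open>\<Phi>\<close>.\<close>

lemma automorphism_families_1:
  assumes A: "vector_bundle A"
  shows "automorphism_families 1 A = unipotent (sections A) ` Der0 A"
proof -
  let ?S = "sections A" and ?C = "smooth_functions A"
  have M: "smooth_manifold A"
    using A by (simp add: vector_bundle_def)
  have mult_iff: "cong_t 2 (\<lambda>t. unipotent ?C \<gamma> t (f * g)) (\<lambda>t. unipotent ?C \<gamma> t f * unipotent ?C \<gamma> t g)
      \<longleftrightarrow> \<gamma> (f * g) = f * \<gamma> g + g * \<gamma> f" if "f \<in> ?C" "g \<in> ?C" for \<gamma> f g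
  proof -
    \<comment> \<open>Closure of the smooth functions under products enters here; without it the
      family would take its default value 0 at f * g.\<close>
    have "(\<lambda>t. unipotent ?C \<gamma> t (f * g)) = (\<lambda>t. f * g + t *\<^sub>R \<gamma> (f * g) + t\<^sup>2 *\<^sub>R 0)"
      using that smooth_functions_mult[OF M] by (simp add: unipotent_def)
    moreover have "(\<lambda>t. unipotent ?C \<gamma> t f * unipotent ?C \<gamma> t g) =
        (\<lambda>t. f * g + t *\<^sub>R (f * \<gamma> g + g * \<gamma> f) + t\<^sup>2 *\<^sub>R (\<gamma> f * \<gamma> g))"
      using that by (simp add: unipotent_def fun_eq_iff algebra_simps power2_eq_square)
    ultimately show ?thesis by (simp only: cong_t_quadratic_iff simp_thms)
  qed
  have fmult_iff: "cong_t 2 (\<lambda>t. unipotent ?S c t (f \<odot> z)) (\<lambda>t. unipotent ?C \<gamma> t f \<odot> unipotent ?S c t z)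
      \<longleftrightarrow> c (f \<odot> z) = f \<odot> c z + \<gamma> f \<odot> z" if "f \<in> ?C" "z \<in> ?S" for \<gamma> c f z
  proof -
    have "(\<lambda>t. unipotent ?S c t (f \<odot> z)) = (\<lambda>t. f \<odot> z + t *\<^sub>R c (f \<odot> z) + t\<^sup>2 *\<^sub>R 0)"
      using that sections_fmult[OF A] by (simp add: unipotent_def)
    moreover have "(\<lambda>t. unipotent ?C \<gamma> t f \<odot> unipotent ?S c t z) =
        (\<lambda>t. f \<odot> z + t *\<^sub>R (f \<odot> c z + \<gamma> f \<odot> z) + t\<^sup>2 *\<^sub>R (\<gamma> f \<odot> c z))"
      using that by (simp add: unipotent_def fmult_def fun_eq_iff algebra_simps power2_eq_square)
    ultimately show ?thesis by (simp only: cong_t_quadratic_iff simp_thms)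
  qed
  show ?thesis
  proof (intro set_eqI iffI)
    fix \<Phi>
    assume "\<Phi> \<in> automorphism_families 1 A"
    then obtain c \<gamma> where c: "c \<in> linear_endos ?S" "\<Phi> = unipotent ?S c"
      and \<gamma>: "\<gamma> \<in> linear_endos ?C"
      and *: "\<And>f g. f \<in> ?C \<Longrightarrow> g \<in> ?C \<Longrightarrow> \<gamma> (f * g) = f * \<gamma> g + g * \<gamma> f"
        "\<And>f z. f \<in> ?C \<Longrightarrow> z \<in> ?S \<Longrightarrow> c (f \<odot> z) = f \<odot> c z + \<gamma> f \<odot> z"
      unfolding automorphism_families_def unipotent_families_1 one_add_one
      by (auto simp: mult_iff fmult_iff)
    \<comment> \<open>A derivation of the algebra becomes a vector field by exchanging its two
      arguments. The value 0 off the manifold is the one that \<open>vector_fields\<close>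
      prescribes.\<close>
    define \<sigma> where "\<sigma> = (\<lambda>p f. if p \<in> points A then \<gamma> f p else 0)"
    have \<sigma>_apply: "vf_apply \<sigma> f = \<gamma> f" if "f \<in> ?C" for f
      using that \<gamma> by (auto simp: vf_apply_def \<sigma>_def fun_eq_iff linear_endos_def smooth_functions_def)
    have "\<sigma> p \<in> tangent_space A p" if "p \<in> points A" for p
      using that \<gamma> *(1)
      by (simp add: tangent_space_def \<sigma>_def linear_endos_def linear_map_on_def)
    then have "\<sigma> \<in> vector_fields A"
      using \<gamma> \<sigma>_apply by (auto simp: vector_fields_def linear_endos_def) (simp add: \<sigma>_def fun_eq_iff)
    then have "c \<in> Der0 A"
      using c *(2) \<sigma>_apply unfolding Der0_def by (auto intro!: bexI[of _ \<sigma>])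
    then show "\<Phi> \<in> unipotent ?S ` Der0 A"
      using c by simp
  next
    fix \<Phi>
    assume "\<Phi> \<in> unipotent ?S ` Der0 A"
    then obtain c \<sigma> where c: "c \<in> linear_endos ?S" "\<Phi> = unipotent ?S c"
      and \<sigma>: "\<sigma> \<in> vector_fields A"
      and *: "\<And>f z. f \<in> ?C \<Longrightarrow> z \<in> ?S \<Longrightarrow> c (f \<odot> z) = f \<odot> c z + vf_apply \<sigma> f \<odot> z"
      unfolding Der0_def by auto
    have tangent: "\<sigma> p \<in> tangent_space A p" if "p \<in> points A" for p
      using \<sigma> that by (simp add: vector_fields_def)
    have outside: "\<sigma> p = 0" if "p \<notin> points A" for p
      using \<sigma> that by (simp add: vector_fields_def)
    have "vf_apply \<sigma> (f + g) p = (vf_apply \<sigma> f + vf_apply \<sigma> g) p" if "f \<in> ?C" "g \<in> ?C" for f g p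
      using tangent[of p] outside[of p] that
      by (cases "p \<in> points A") (auto simp: vf_apply_def tangent_space_def linear_map_on_def)
    moreover have "vf_apply \<sigma> (r *\<^sub>R f) p = (r *\<^sub>R vf_apply \<sigma> f) p" if "f \<in> ?C" for r f p
      using tangent[of p] outside[of p] that
      by (cases "p \<in> points A") (auto simp: vf_apply_def tangent_space_def linear_map_on_def)
    \<comment> \<open>Tangent vectors vanish by convention on functions that are not smooth, which
      is the default value demanded by \<open>linear_endos\<close>.\<close>
    moreover have "vf_apply \<sigma> f p = 0" if "f \<notin> ?C" for f p
      using tangent[of p] outside[of p] that
      by (cases "p \<in> points A") (auto simp: vf_apply_def tangent_space_def)
    moreover have "vf_apply \<sigma> f \<in> ?C" if "f \<in> ?C" for f
      using \<sigma> that by (simp add: vector_fields_def)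
    ultimately have endo: "vf_apply \<sigma> \<in> linear_endos ?C"
      by (simp add: linear_endos_def linear_map_on_def fun_eq_iff)
    have "vf_apply \<sigma> (f * g) p = (f * vf_apply \<sigma> g + g * vf_apply \<sigma> f) p"
      if "f \<in> ?C" "g \<in> ?C" for f g p
      using tangent[of p] outside[of p] that
      by (cases "p \<in> points A") (auto simp: vf_apply_def tangent_space_def)
    then have leibniz: "vf_apply \<sigma> (f * g) = f * vf_apply \<sigma> g + g * vf_apply \<sigma> f"
      if "f \<in> ?C" "g \<in> ?C" for f g
      using that by (intro ext)
    show "\<Phi> \<in> automorphism_families 1 A"
      unfolding automorphism_families_def one_add_one c(2)
      using c(1) * endo leibniz
      by (auto simp: mult_iff fmult_iff unipotent_families_1 simp del: One_nat_def
          intro!: bexI[of _ "vf_apply \<sigma>"])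
  qed
qed

section \<open>Infinitesimal deformations\<close>

lemma circ11_add_left:
  "circ11 n (D + t *\<^sub>R E) F X\<^sub>1 X\<^sub>2 z = circ11 n D F X\<^sub>1 X\<^sub>2 z + t *\<^sub>R circ11 n E F X\<^sub>1 X\<^sub>2 z"
  by (simp add: circ11_def sum.distrib scaleR_sum_right algebra_simps)

text \<open>The right operator is evaluated inside the arguments of D. Additivity therefore uses
  multilinearity of D and needs the inserted values to lie in \<open>S\<close>.\<close>

lemma circ11_add_right:
  assumes S: "subspace S" and n: "1 \<le> n" and D: "multilinear_map_on n S D"
    and E: "\<And>xs. xs \<in> tuples n S \<Longrightarrow> E xs \<in> S" and F: "\<And>xs. xs \<in> tuples n S \<Longrightarrow> F xs \<in> S"
    and X: "X\<^sub>1 \<in> tuples (n - 1) S" "X\<^sub>2 \<in> tuples (n - 1) S" and z: "z \<in> S"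
  shows "circ11 n D (E + t *\<^sub>R F) X\<^sub>1 X\<^sub>2 z = circ11 n D E X\<^sub>1 X\<^sub>2 z + t *\<^sub>R circ11 n D F X\<^sub>1 X\<^sub>2 z"
proof -
  have upd: "D (xs[i := (E + t *\<^sub>R F) ys]) = D (xs[i := E ys]) + t *\<^sub>R D (xs[i := F ys])"
    if "xs \<in> tuples n S" "ys \<in> tuples n S" "i < n" for xs ys i
    using that E F S
    by (simp add: multilinear_update_add[OF D] multilinear_update_scaleR[OF D] subspace_scale)
  have len: "length X\<^sub>1 = n - 1" "length X\<^sub>2 = n - 1"
    using X by (auto simp: tuples_def)
  have last: "D (X @ [(E + t *\<^sub>R F) ys]) = D (X @ [E ys]) + t *\<^sub>R D (X @ [F ys])"
    if "X \<in> tuples (n - 1) S" "ys \<in> tuples n S" for X ys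
  proof -
    \<comment> \<open>The final entry is treated as an update at index n - 1, so that
      \<open>upd\<close> applies; z is a mere placeholder.\<close>
    have "(X @ [z])[n - 1 := y] = X @ [y]" for y
      using that by (simp add: list_update_append tuples_def)
    then show ?thesis
      using upd[OF tuples_snoc[OF that(1) z n] that(2), of "n - 1"] n by simp
  qed
  have inner: "D (X\<^sub>2[s := (E + t *\<^sub>R F) (X\<^sub>1 @ [X\<^sub>2 ! s])] @ [z]) =
      D (X\<^sub>2[s := E (X\<^sub>1 @ [X\<^sub>2 ! s])] @ [z]) + t *\<^sub>R D (X\<^sub>2[s := F (X\<^sub>1 @ [X\<^sub>2 ! s])] @ [z])"
    if "s < n - 1" for s
    using upd[OF tuples_snoc[OF X(2) z n] tuples_snoc[OF X(1) tuples_nth[OF X(2) that] n], of s]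
      that len by (simp add: list_update_append)
  show ?thesis
    using last[OF X(1) tuples_snoc[OF X(2) z n]] last[OF X(2) tuples_snoc[OF X(1) z n]]
    unfolding circ11_def
    by (simp add: inner sum.distrib scaleR_sum_right algebra_simps del: One_nat_def plus_fun_apply scaleR_fun_apply)
qed

text \<open>The bracket symmetrises \<open>circ11\<close>, so the two mixed terms coincide; this is
  the origin of the factor 2.\<close>

lemma bracket11_family:
  assumes S: "subspace (sections A)" and n: "1 \<le> n"
    and D: "multilinear_map_on n (sections A) D" "\<And>xs. xs \<in> tuples n (sections A) \<Longrightarrow> D xs \<in> sections A"
    and E: "multilinear_map_on n (sections A) E" "\<And>xs. xs \<in> tuples n (sections A) \<Longrightarrow> E xs \<in> sections A"
  shows "bracket11 n A (D + t *\<^sub>R E) (D + t *\<^sub>R E) =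
    bracket11 n A D D + t *\<^sub>R (2 *\<^sub>R bracket11 n A D E) + t\<^sup>2 *\<^sub>R bracket11 n A E E"
proof (intro ext)
  fix X\<^sub>1 X\<^sub>2 z p
  show "bracket11 n A (D + t *\<^sub>R E) (D + t *\<^sub>R E) X\<^sub>1 X\<^sub>2 z p =
    (bracket11 n A D D + t *\<^sub>R (2 *\<^sub>R bracket11 n A D E) + t\<^sup>2 *\<^sub>R bracket11 n A E E) X\<^sub>1 X\<^sub>2 z p"
    using circ11_add_right[OF S n D(1) D(2) E(2)] circ11_add_right[OF S n E(1) D(2) E(2)]
    by (simp add: bracket11_def circ11_add_left algebra_simps power2_eq_square scaleR_2)
qed

text \<open>Splitting the last summand, where the bracket acts on z, off the Filippov identity
  leaves exactly the vanishing of \<open>circ11\<close>.\<close>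

lemma filippov_algebra_bracket11:
  assumes "1 \<le> n" "filippov_algebra n (sections A) br"
  shows "bracket11 n A br br = 0"
proof -
  have "circ11 n br br X\<^sub>1 X\<^sub>2 z = 0"
    if X: "X\<^sub>1 \<in> tuples (n - 1) (sections A)" "X\<^sub>2 \<in> tuples (n - 1) (sections A)"
      and z: "z \<in> sections A" for X\<^sub>1 X\<^sub>2 z
  proof -
    have len: "length X\<^sub>2 = n - 1" using X by (simp add: tuples_def)
    have "br (X\<^sub>1 @ [br (X\<^sub>2 @ [z])]) =
        (\<Sum>i<Suc (n - 1). br ((X\<^sub>2 @ [z])[i := br (X\<^sub>1 @ [(X\<^sub>2 @ [z]) ! i])]))"
      using assms X tuples_snoc[OF X(2) z assms(1)] by (simp add: filippov_algebra_def)
    also have "\<dots> = (\<Sum>i<n - 1. br (X\<^sub>2[i := br (X\<^sub>1 @ [X\<^sub>2 ! i])] @ [z])) + br (X\<^sub>2 @ [br (X\<^sub>1 @ [z])])"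
      using len by (simp add: list_update_append nth_append)
    finally show ?thesis by (simp add: circ11_def)
  qed
  then show ?thesis by (simp add: bracket11_def fun_eq_iff)
qed

lemma infinitesimal_deformations_eq:
  assumes n: "1 \<le> n" and br: "filippov_algebra n (sections A) br"
  shows "infinitesimal_deformations n A br = (\<lambda>\<psi> t. br + t *\<^sub>R \<psi>) ` cocycles2 n A br"
proof -
  have "cong_t 2 (\<lambda>t. bracket11 n A (br + t *\<^sub>R \<psi>) (br + t *\<^sub>R \<psi>)) (\<lambda>t. 0) \<longleftrightarrow> bracket11 n A br \<psi> = 0"
    if "\<psi> \<in> Der1 n A" for \<psi>
  proof -
    have "bracket11 n A (br + t *\<^sub>R \<psi>) (br + t *\<^sub>R \<psi>) =
        0 + t *\<^sub>R (2 *\<^sub>R bracket11 n A br \<psi>) + t\<^sup>2 *\<^sub>R bracket11 n A \<psi> \<psi>" for t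
      \<comment> \<open>The constant term 0 is rewritten backwards as
        \<open>bracket11 n A br br\<close>, which makes the equation an instance of
        \<open>bracket11_family\<close>.\<close>
      using br that n unfolding filippov_algebra_bracket11[OF n br, symmetric]
      by (intro bracket11_family) (auto simp: filippov_algebra_def Der1_def)
    then show ?thesis
      using cong_t_quadratic_iff[of 0 "2 *\<^sub>R bracket11 n A br \<psi>" "bracket11 n A \<psi> \<psi>" 0 0 0] by simp
  qed
  note cocycle = this
  show ?thesis
    unfolding deformations_def cocycles2_def one_add_one
  proof (intro set_eqI iffI)
    fix \<phi>\<^sub>t
    assume "\<phi>\<^sub>t \<in> {\<phi>\<^sub>t. (\<exists>\<psi>. (\<forall>i\<in>{1..1}. \<psi> i \<in> Der1 n A) \<and> \<phi>\<^sub>t = (\<lambda>t. br + (\<Sum>i=1..1. t ^ i *\<^sub>R \<psi> i))) \<and>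
          cong_t 2 (\<lambda>t. bracket11 n A (\<phi>\<^sub>t t) (\<phi>\<^sub>t t)) (\<lambda>t. 0)}"
    then show "\<phi>\<^sub>t \<in> (\<lambda>\<psi> t. br + t *\<^sub>R \<psi>) ` {\<psi> \<in> Der1 n A. bracket11 n A br \<psi> = 0}"
      by (auto simp: cocycle)
  next
    fix \<phi>\<^sub>t
    assume "\<phi>\<^sub>t \<in> (\<lambda>\<psi> t. br + t *\<^sub>R \<psi>) ` {\<psi> \<in> Der1 n A. bracket11 n A br \<psi> = 0}"
    then obtain \<psi> where "\<psi> \<in> Der1 n A" "bracket11 n A br \<psi> = 0" "\<phi>\<^sub>t = (\<lambda>t. br + t *\<^sub>R \<psi>)"
      by blast
    then show "\<phi>\<^sub>t \<in> {\<phi>\<^sub>t. (\<exists>\<psi>. (\<forall>i\<in>{1..1}. \<psi> i \<in> Der1 n A) \<and> \<phi>\<^sub>t = (\<lambda>t. br + (\<Sum>i=1..1. t ^ i *\<^sub>R \<psi> i))) \<and>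
          cong_t 2 (\<lambda>t. bracket11 n A (\<phi>\<^sub>t t) (\<phi>\<^sub>t t)) (\<lambda>t. 0)}"
      by (auto simp: cocycle intro: exI[of _ "\<lambda>_. \<psi>"])
  qed
qed

text \<open>The outer map Id - tc acts exactly, giving D(\<Phi>) + t (E(\<Phi>) - c(D(\<Phi>)) - t
  c(E(\<Phi>))), where \<Phi> is the perturbed list. Only D(\<Phi>) must be expanded modulo t^2;
  everything in the parentheses is needed modulo t alone.\<close>

lemma conjugate_family:
  assumes S: "subspace S" and c: "c \<in> linear_endos S"
    and D: "multilinear_map_on n S D" "\<And>xs. xs \<in> tuples n S \<Longrightarrow> D xs \<in> S"
    and E: "multilinear_map_on n S E" "\<And>xs. xs \<in> tuples n S \<Longrightarrow> E xs \<in> S"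
    and xs: "xs \<in> tuples n S"
  shows "cong_t 2 (\<lambda>t. unipotent S (- c) t ((D + t *\<^sub>R E) (map (unipotent S c t) xs)))
    (\<lambda>t. D xs + t *\<^sub>R (E xs + ((\<Sum>i<n. D (xs[i := c (xs ! i)])) - c (D xs))))"
proof -
  let ?\<Phi> = "\<lambda>t. map (\<lambda>x. x + t *\<^sub>R c x) xs"
  have c_in: "\<And>x. x \<in> S \<Longrightarrow> c x \<in> S" and lin: "linear_map_on S c"
    using c by (auto simp: linear_endos_def)
  have \<Phi>_in: "?\<Phi> t \<in> tuples n S" for t
    using xs S c_in by (auto simp: tuples_def subset_iff intro!: subspace_add subspace_scale)
  have map_eq: "map (unipotent S c t) xs = ?\<Phi> t" for t
    using xs by (auto simp: tuples_def unipotent_def)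
  have "unipotent S (- c) t ((D + t *\<^sub>R E) (?\<Phi> t)) =
      D (?\<Phi> t) + t *\<^sub>R (E (?\<Phi> t) + - c (D (?\<Phi> t)) + t *\<^sub>R - c (E (?\<Phi> t)))" for t
  proof -
    have in_S: "D (?\<Phi> t) \<in> S" "t *\<^sub>R E (?\<Phi> t) \<in> S" "E (?\<Phi> t) \<in> S"
      using D E S \<Phi>_in by (auto intro: subspace_scale)
    then have "D (?\<Phi> t) + t *\<^sub>R E (?\<Phi> t) \<in> S"
      using S by (intro subspace_add)
    moreover have "c (D (?\<Phi> t) + t *\<^sub>R E (?\<Phi> t)) = c (D (?\<Phi> t)) + t *\<^sub>R c (E (?\<Phi> t))"
      using lin in_S by (simp add: linear_map_on_def)
    ultimately show ?thesis
      by (simp add: unipotent_def algebra_simps)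
  qed
  note expand = this
  \<comment> \<open>Composing with -c preserves multilinearity, so \<open>zeroth\<close> applies to
    these terms just as it does to E.\<close>
  have comp: "multilinear_map_on n S (\<lambda>ys. - c (F ys))"
    if F: "multilinear_map_on n S F" "\<And>ys. ys \<in> tuples n S \<Longrightarrow> F ys \<in> S" for F
    using that lin unfolding multilinear_map_on_def linear_map_on_def
    by (simp add: tuples_update)
  have zeroth: "cong_t 1 (\<lambda>t. F (?\<Phi> t)) (\<lambda>t. F xs)"
    if F: "multilinear_map_on n S F" for F :: "'a list \<Rightarrow> 'a"
  proof -
    have "cong_t 1 (\<lambda>t. F (?\<Phi> t)) (\<lambda>t. F xs + t *\<^sub>R (\<Sum>i<n. F (xs[i := c (xs ! i)])))"
      using multilinear_expand[OF S F c_in xs] by (rule cong_t_mono) simp_all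
    moreover have "cong_t 1 (\<lambda>t. F xs + t *\<^sub>R v) (\<lambda>t. F xs)" for v
      unfolding cong_t_def by (intro exI[of _ 1] exI[of _ "\<lambda>_. v"]) simp
    ultimately show ?thesis by (rule cong_t_trans)
  qed
  have "cong_t 1 (\<lambda>t. t *\<^sub>R - c (E (?\<Phi> t))) (\<lambda>t. t *\<^sub>R - c (E xs))"
    using cong_t_mono[OF cong_t_mult_t[OF zeroth[OF comp[OF E]]], of 1] by simp
  moreover have "cong_t 1 (\<lambda>t. t *\<^sub>R - c (E xs)) (\<lambda>t. 0)"
    unfolding cong_t_def by (intro exI[of _ 1] exI[of _ "\<lambda>_. - c (E xs)"]) simp
  ultimately have "cong_t 1 (\<lambda>t. t *\<^sub>R - c (E (?\<Phi> t))) (\<lambda>t. 0)"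
    by (rule cong_t_trans)
  then have "cong_t 1 (\<lambda>t. E (?\<Phi> t) + - c (D (?\<Phi> t)) + t *\<^sub>R - c (E (?\<Phi> t))) (\<lambda>t. E xs + - c (D xs) + 0)"
    by (intro cong_t_add zeroth E comp D)
  \<comment> \<open>The factor t lifts the congruence modulo t to one modulo t^2.\<close>
  from cong_t_mult_t[OF this]
  have "cong_t 2 (\<lambda>t. t *\<^sub>R (E (?\<Phi> t) + - c (D (?\<Phi> t)) + t *\<^sub>R - c (E (?\<Phi> t))))
      (\<lambda>t. t *\<^sub>R (E xs + - c (D xs)))"
    by (simp add: numeral_2_eq_2)
  from cong_t_add[OF multilinear_expand[OF S D(1) c_in xs] this]
  show ?thesis
    unfolding map_eq expand by (simp add: algebra_simps)
qed

lemma equivalent_iff_cohomologous: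
  assumes n: "1 \<le> n" and A: "vector_bundle A" and br: "filippov_algebra n (sections A) br"
    and \<psi>: "\<psi> \<in> cocycles2 n A br" and \<psi>': "\<psi>' \<in> cocycles2 n A br"
  shows "((\<lambda>t. br + t *\<^sub>R \<psi>), (\<lambda>t. br + t *\<^sub>R \<psi>')) \<in> equivalent_deformations 1 n A br
    \<longleftrightarrow> (\<psi>, \<psi>') \<in> cohomologous n A br"
proof -
  let ?S = "sections A"
  have S: "subspace ?S" and mult: "multilinear_map_on n ?S br" "multilinear_map_on n ?S \<psi>"
    and in_S: "\<And>xs. xs \<in> tuples n ?S \<Longrightarrow> br xs \<in> ?S" "\<And>xs. xs \<in> tuples n ?S \<Longrightarrow> \<psi> xs \<in> ?S"
    and outside: "\<And>xs. xs \<notin> tuples n ?S \<Longrightarrow> \<psi> xs = 0" "\<And>xs. xs \<notin> tuples n ?S \<Longrightarrow> \<psi>' xs = 0"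
    using br \<psi> \<psi>' by (auto simp: filippov_algebra_def cocycles2_def Der1_def)
  have conj_iff: "(\<forall>xs\<in>tuples n ?S. cong_t 2 (\<lambda>t. (br + t *\<^sub>R \<psi>') xs)
        (\<lambda>t. unipotent ?S (- N) t ((br + t *\<^sub>R \<psi>) (map (unipotent ?S N t) xs))))
      \<longleftrightarrow> \<psi>' - \<psi> = bracket10 n A br N" if "N \<in> linear_endos ?S" for N
  proof -
    have "cong_t 2 (\<lambda>t. (br + t *\<^sub>R \<psi>') xs)
          (\<lambda>t. unipotent ?S (- N) t ((br + t *\<^sub>R \<psi>) (map (unipotent ?S N t) xs)))
        \<longleftrightarrow> \<psi>' xs = \<psi> xs + bracket10 n A br N xs" if xs: "xs \<in> tuples n ?S" for xs
    proof -
      note conj = conjugate_family[OF S \<open>N \<in> linear_endos ?S\<close> mult(1) in_S(1) mult(2) in_S(2) xs]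
      have "cong_t 2 (\<lambda>t. (br + t *\<^sub>R \<psi>') xs)
            (\<lambda>t. unipotent ?S (- N) t ((br + t *\<^sub>R \<psi>) (map (unipotent ?S N t) xs)))
          \<longleftrightarrow> cong_t 2 (\<lambda>t. br xs + t *\<^sub>R \<psi>' xs) (\<lambda>t. br xs + t *\<^sub>R (\<psi> xs + bracket10 n A br N xs))"
        using conj xs cong_t_trans[OF _ conj] cong_t_trans[OF _ cong_t_sym[OF conj]]
        by (auto simp: bracket10_def)
      then show ?thesis by (simp only: cong_t_affine_iff simp_thms)
    qed
    \<comment> \<open>Outside the tuples \<psi>, \<psi>' and the coboundary are all 0, so agreement
      on tuples becomes equality of functions.\<close>
    then have "(\<forall>xs\<in>tuples n ?S. cong_t 2 (\<lambda>t. (br + t *\<^sub>R \<psi>') xs)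
          (\<lambda>t. unipotent ?S (- N) t ((br + t *\<^sub>R \<psi>) (map (unipotent ?S N t) xs))))
        \<longleftrightarrow> (\<forall>xs. \<psi>' xs = \<psi> xs + bracket10 n A br N xs)"
      using outside by (auto simp: bracket10_def)
    also have "\<dots> \<longleftrightarrow> \<psi>' - \<psi> = bracket10 n A br N"
      by (subst fun_eq_iff) (simp add: diff_eq_eq add.commute)
    finally show ?thesis .
  qed
  have Der0: "N \<in> linear_endos ?S" if "N \<in> Der0 A" for N
    using that by (simp add: Der0_def)
  have "(\<lambda>t. br + t *\<^sub>R \<psi>) \<in> infinitesimal_deformations n A br"
      "(\<lambda>t. br + t *\<^sub>R \<psi>') \<in> infinitesimal_deformations n A br"
    unfolding infinitesimal_deformations_eq[OF n br] using \<psi> \<psi>' by auto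
  then have "((\<lambda>t. br + t *\<^sub>R \<psi>), (\<lambda>t. br + t *\<^sub>R \<psi>')) \<in> equivalent_deformations 1 n A br
    \<longleftrightarrow> (\<exists>N\<in>Der0 A. \<forall>xs\<in>tuples n ?S. cong_t 2 (\<lambda>t. (br + t *\<^sub>R \<psi>') xs)
        (\<lambda>t. unipotent ?S (- N) t ((br + t *\<^sub>R \<psi>) (map (unipotent ?S N t) xs))))"
    \<comment> \<open>The automorphisms are now the families Id + tN with N in
      \<open>Der0 A\<close>, and the quantifier over inverses collapses to Id - tN.\<close>
    unfolding equivalent_deformations_def automorphism_families_1[OF A] one_add_one
    by (simp add: inverse_mod_1_iff[OF S Der0] del: One_nat_def)
  also have "\<dots> \<longleftrightarrow> (\<psi>, \<psi>') \<in> cohomologous n A br"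
    using \<psi> \<psi>' by (auto simp: cohomologous_def conj_iff Der0 image_iff
        simp del: plus_fun_apply scaleR_fun_apply)
  finally show ?thesis .
qed

text \<open>Both quotients consist of relational images of points, so a bijection matching the
  relations carries one onto the other. Taking images is injective on subsets of \<open>Z\<close>
  because f is. The second conclusion records the value on each class.\<close>

lemma bij_betw_quotient_image:
  assumes f: "bij_betw f Z D" and R: "R \<subseteq> Z \<times> Z" "R' \<subseteq> D \<times> D"
    and iff: "\<And>x y. x \<in> Z \<Longrightarrow> y \<in> Z \<Longrightarrow> (f x, f y) \<in> R' \<longleftrightarrow> (x, y) \<in> R"
  shows "bij_betw ((`) f) (Z // R) (D // R')"
    and "\<And>x. x \<in> Z \<Longrightarrow> f ` (R `` {x}) = R' `` {f x}"
proof -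
  have D: "D = f ` Z" and inj: "inj_on f Z"
    using f by (auto simp: bij_betw_def)
  show image: "f ` (R `` {x}) = R' `` {f x}" if "x \<in> Z" for x
    using that R iff unfolding D by (fastforce simp: image_iff)
  have "inj_on ((`) f) (Z // R)"
  proof (rule inj_onI)
    fix B C
    assume "B \<in> Z // R" "C \<in> Z // R" and eq: "f ` B = f ` C"
    then have "B \<subseteq> Z" "C \<subseteq> Z"
      using R(1) by (auto simp: quotient_def)
    with eq show "B = C"
      using inj by (simp add: inj_on_image_eq_iff)
  qed
  moreover have "(`) f ` (Z // R) = D // R'"
    using image unfolding D quotient_def by auto
  ultimately show "bij_betw ((`) f) (Z // R) (D // R')"
    by (simp add: bij_betw_def)
qed

text \<open>A bare bijection would only compare cardinalities; the second conjunct fixes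
  \<open>h\<close> as the map on classes that sends \<psi> to the family
  \<open>br + t *\<^sub>R \<psi>\<close>.\<close>

theorem theorem5p5:
  fixes n :: nat
    and A :: "('m, 'e::real_vector) vbundle"
    and br :: "('m \<Rightarrow> 'e) list \<Rightarrow> 'm \<Rightarrow> 'e"
    and a :: "'m \<Rightarrow> 'e list \<Rightarrow> ('m \<Rightarrow> real) \<Rightarrow> real"
  assumes "2 \<le> n" and "filippov_algebroid n A br a"
  shows "\<exists>h. bij_betw h (H2F n A br) (infinitesimal_deformation_classes n A br) \<and>
           (\<forall>\<psi>\<in>cocycles2 n A br.
              h (cohomologous n A br `` {\<psi>}) =
                equivalent_deformations 1 n A br `` {\<lambda>t. br + t *\<^sub>R \<psi>})"
proof -
  have n: "1 \<le> n" and A: "vector_bundle A" and br: "filippov_algebra n (sections A) br"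
    using assms by (auto simp: filippov_algebroid_def)
  let ?f = "\<lambda>\<psi> t. br + t *\<^sub>R \<psi>"
  \<comment> \<open>Evaluating at t = 1 and cancelling \<open>br\<close> recovers the
    cocycle.\<close>
  have "\<psi> = \<psi>'" if "?f \<psi> = ?f \<psi>'" for \<psi> \<psi>'
    using fun_cong[OF that, of 1] by simp
  then have f: "bij_betw ?f (cocycles2 n A br) (infinitesimal_deformations n A br)"
    by (simp add: bij_betw_def inj_on_def infinitesimal_deformations_eq[OF n br] del: One_nat_def)
  have R: "cohomologous n A br \<subseteq> cocycles2 n A br \<times> cocycles2 n A br"
    "equivalent_deformations 1 n A br \<subseteq>
      infinitesimal_deformations n A br \<times> infinitesimal_deformations n A br"
    by (auto simp: cohomologous_def equivalent_deformations_def)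
  note quotient = bij_betw_quotient_image[OF f R equivalent_iff_cohomologous[OF n A br]]
  show ?thesis
    unfolding H2F_def infinitesimal_deformation_classes_def
    by (intro exI[of _ "(`) ?f"] conjI ballI quotient)
qed

end
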